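(* Assume that $\mathcal D=\ker\omega$ is nowhere integrable (i.e. $(\omega\wedge d\omega)_p\ne0$ for all $p\in S$) and that assumptions (i) and (ii) stated in the context hold. Let $x_0,x_1\in S$, let $K\subset W^{1,2}_{x_0x_1}(S)$ be a compact subset, let $j:\Omega^{1,2}(x_1)\to W^{1,2}_{x_0x_1}(S)$ be the inclusion and let $f:W^{1,2}_{x_0x_1}(S)\to\Omega^{1,2}(x_1)$ be a homotopy inverse of $j$. Then $$\sup_{\sigma\in j(f(K))}E(\sigma)<+\infty,$$ where $E(\sigma)=\frac12\int_0^1F^2(\dot\sigma)\,ds$ is the energy functional of the Randers-Kropina metric $F$.
   Context: $S$ is a connected smooth manifold of finite dimension $m\ge 2$, with a smooth Riemannian metric $g_0$, a smooth one-form $\omega$ and a smooth function $\Lambda:S\to\mathbb R$, with $\Lambda\geq 0$ and $\omega_x\neq 0$ for all $x\in S$. $\|\omega\|_x$ is the $g_0$-norm of $\omega_x$; $\pi:TS\to S$ is the projection; $\mathcal D_x=\ker\omega_x$; $I=[0,1]$. The Randers-Kropina metric is $$F(v)=\frac{g_0(v,v)}{-\omega(v)+\sqrt{\Lambda g_0(v,v)+\omega^2(v)}},$$ defined for $v$ with $\Lambda(\pi(v))>0$ (with $F(0)=0$), and for $v$ with $\Lambda(\pi(v))=0$ and $\omega(v)<0$, where it equals the Kropina metric $-\frac{g_0(v,v)}{2\omega(v)}$. Convention used when evaluating $E$ on curves whose velocity may vanish on subintervals: the value of $-g_0(v,v)/\omega(v)$ at $v=0$ is set equal to $1$, so $F(0_x)=\frac12$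 at points with $\Lambda(x)=0$. $W^{1,2}_{x_0x_1}(S)$ is the Sobolev manifold of absolutely continuous curves $\sigma:I\to S$ with $\sigma(0)=x_0$, $\sigma(1)=x_1$, $\int_0^1g_0(\dot\sigma,\dot\sigma)\,ds<+\infty$, with its $W^{1,2}$-topology. Assumptions. (i) $\bar\omega:=\sup_{x\in S}\|\omega\|_x<+\infty$. (ii) There is a countable covering $\{U_{z_k}\}_{k\in\mathbb N}$ of $S$ by open neighbourhoods $U_{z_k}$ of points $z_k\in S$ such that on each $U_{z_k}$ there is a smooth frame $Y_1,\dots,Y_{m-1}$ of $\mathcal D$ with $g_0(Y_i,Y_i)=1$ for all $i$ and $\lambda_{z_k}:=\inf_{U_{z_k}}(-\omega([Y_1,Y_2]))>0$, and $\lambda:=\inf_k\lambda_{z_k}>0$. Such a covering with frames is fixed, and $C:=\big(5(m+3)\bar\omega/\lambda\big)^{1/2}$. Control system. $X_1,\dots,X_d$ ($d\ge\mathrm{rank}\,\mathcal D$) are fixed globally defined smooth vector fields on $S$ generating $\mathcal D$ such that for all $v\in\mathcal D$, with $x=\pi(v)$, $g_0(v,v)=\min\{\sum_{i=1}^du_i^2: v=\sum_{i=1}^du_i(X_i)_x\}$. $X_0$ is the smooth $g_0$-unit vector field $g_0$-orthogonal to $\mathcal D$ with $-\omega(X_0)=\|\omega\|$. Consider $$\dot\sigma=u_0X_0(\sigma)+\sum_{i=1}^du_iX_i(\sigma)\ \text{ a.e. on } I,\qquad\sigma(0)=x_0.\qquad( * )$$ Admissible controls $\mathfrak A$: measurable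 $u=(u_0,\dots,u_d):I\to\mathbb R^{d+1}$ for which there exists a (finite) partition $P$ of $I$ into intervals such that for each $J\in P$ there are a constant $\xi_J\ge0$ and measurable functions $\alpha_{Ji}:J\to\mathbb R$, $i=1,\dots,d$, with $\sup_{s\in J}\sum_{i=1}^d\alpha_{Ji}^2(s)\le C^2$, $u_0|_J=\xi_J^2$ and $u_i|_J=\xi_J\alpha_{Ji}$ for $i=1,\dots,d$. $\Omega^{1,2}(x_1)$ is the set of solutions $\sigma:I\to S$ of $( * )$ with control $u\in\mathfrak A$ and $\sigma(1)=x_1$, endowed with the $W^{1,2}$-topology (as a subspace of $W^{1,2}_{x_0x_1}(S)$). *)

theory Defs
  imports "HOL-Analysis.Analysis"
begin

section \<open>Smooth maps between Euclidean spaces\<close>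

text \<open>Only meaningful for open \<open>S\<close>.\<close>

fun Ck_on :: "nat \<Rightarrow> 'a::euclidean_space set \<Rightarrow> ('a \<Rightarrow> 'b::real_normed_vector) \<Rightarrow> bool" where
  "Ck_on 0 S f \<longleftrightarrow> continuous_on S f"
| "Ck_on (Suc k) S f \<longleftrightarrow> (\<forall>x\<in>S. f differentiable at x) \<and>
     (\<forall>v. Ck_on k S (\<lambda>x. frechet_derivative f (at x) v))"

definition smooth_on :: "'a::euclidean_space set \<Rightarrow> ('a \<Rightarrow> 'b::real_normed_vector) \<Rightarrow> bool" where
  "smooth_on S f \<longleftrightarrow> (\<forall>k. Ck_on k S f)"


section \<open>Smooth manifolds and tangent vectors\<close>

text \<open>The manifold is the whole type \<open>'a\<close>, which is Hausdorff and second countable; its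
  dimension is \<open>CARD('n)\<close>. A chart is a pair of its domain and its coordinate map (whose values
  outside the domain are irrelevant). Atlases need not be maximal.\<close>

type_synonym ('a, 'n) chart = "'a set \<times> ('a \<Rightarrow> real ^ 'n)"

definition param :: "('a, 'n::finite) chart \<Rightarrow> real ^ 'n \<Rightarrow> 'a" where
  "param c = inv_into (fst c) (snd c)"

definition transition :: "('a, 'n::finite) chart \<Rightarrow> ('a, 'n) chart \<Rightarrow> real ^ 'n \<Rightarrow> real ^ 'n" where
  "transition c c' = snd c' \<circ> param c"

definition smooth_atlas ::
    "('a::{t2_space, second_countable_topology}, 'n::finite) chart set \<Rightarrow> bool" where
  "smooth_atlas A \<longleftrightarrow>
     (\<forall>c\<in>A. open (fst c) \<and> open (snd c ` fst c) \<and>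
            homeomorphism (fst c) (snd c ` fst c) (snd c) (param c)) \<and>
     (\<Union>c\<in>A. fst c) = UNIV \<and>
     (\<forall>c\<in>A. \<forall>c'\<in>A. smooth_on (snd c ` (fst c \<inter> fst c')) (transition c c'))"

definition smooth_fun :: "('a, 'n::finite) chart set \<Rightarrow> ('a \<Rightarrow> real) \<Rightarrow> bool" where
  "smooth_fun A h \<longleftrightarrow> (\<forall>c\<in>A. smooth_on (snd c ` fst c) (\<lambda>y. h (param c y)))"

text \<open>A tangent vector at \<open>p\<close> is the family of its components with respect to all charts around
  \<open>p\<close>, related by the differentials of the transition maps. The components in charts whose
  domain does not contain \<open>p\<close> are set to 0, so that equality is equality of functions; the vector
  space operations are pointwise.\<close>

type_synonym ('a, 'n) tvec = "('a, 'n) chart \<Rightarrow> real ^ 'n"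

definition tangent_space :: "('a, 'n::finite) chart set \<Rightarrow> 'a \<Rightarrow> ('a, 'n) tvec set" where
  "tangent_space A p = {v.
     (\<forall>c\<in>A. \<forall>c'\<in>A. p \<in> fst c \<inter> fst c' \<longrightarrow>
        v c' = frechet_derivative (transition c c') (at (snd c p)) (v c)) \<and>
     (\<forall>c. c \<notin> A \<or> p \<notin> fst c \<longrightarrow> v c = 0)}"

definition tzero :: "('a, 'n::finite) tvec" where
  "tzero = (\<lambda>c. 0)"

definition lincomb :: "nat set \<Rightarrow> (nat \<Rightarrow> real) \<Rightarrow> (nat \<Rightarrow> ('a, 'n::finite) tvec) \<Rightarrow> ('a, 'n) tvec" where
  "lincomb I a V = (\<lambda>c. \<Sum>i\<in>I. a i *\<^sub>R V i c)"

definition chart_vector ::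
    "('a, 'n::finite) chart set \<Rightarrow> ('a, 'n) chart \<Rightarrow> 'a \<Rightarrow> real ^ 'n \<Rightarrow> ('a, 'n) tvec" where
  \<comment> \<open>the tangent vector at \<open>p\<close> whose components in the chart \<open>c\<close> are \<open>e\<close>\<close>
  "chart_vector A c p e = (\<lambda>c'. if c' \<in> A \<and> p \<in> fst c'
     then frechet_derivative (transition c c') (at (snd c p)) e else 0)"

definition tangent_linear ::
    "('a, 'n::finite) chart set \<Rightarrow> 'a \<Rightarrow> (('a, 'n) tvec \<Rightarrow> real) \<Rightarrow> bool" where
  "tangent_linear A p h \<longleftrightarrow> (\<forall>v\<in>tangent_space A p. \<forall>w\<in>tangent_space A p. \<forall>a b.
     h (\<lambda>c. a *\<^sub>R v c + b *\<^sub>R w c) = a * h v + b * h w)"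


section \<open>Vector fields, one-forms and Riemannian metrics\<close>

definition smooth_vector_field_on ::
    "('a, 'n::finite) chart set \<Rightarrow> 'a set \<Rightarrow> ('a \<Rightarrow> ('a, 'n) tvec) \<Rightarrow> bool" where
  "smooth_vector_field_on A U X \<longleftrightarrow> (\<forall>p\<in>U. X p \<in> tangent_space A p) \<and>
     (\<forall>c\<in>A. smooth_on (snd c ` (fst c \<inter> U)) (\<lambda>y. X (param c y) c))"

definition lie_bracket ::
    "('a, 'n::finite) chart set \<Rightarrow> ('a \<Rightarrow> ('a, 'n) tvec) \<Rightarrow> ('a \<Rightarrow> ('a, 'n) tvec)
     \<Rightarrow> 'a \<Rightarrow> ('a, 'n) tvec" where
  "lie_bracket A X Y p = (\<lambda>c. if c \<in> A \<and> p \<in> fst c then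
     frechet_derivative (\<lambda>y. Y (param c y) c) (at (snd c p)) (X p c) -
     frechet_derivative (\<lambda>y. X (param c y) c) (at (snd c p)) (Y p c) else 0)"

definition smooth_one_form ::
    "('a, 'n::finite) chart set \<Rightarrow> ('a \<Rightarrow> ('a, 'n) tvec \<Rightarrow> real) \<Rightarrow> bool" where
  "smooth_one_form A \<omega> \<longleftrightarrow> (\<forall>p. tangent_linear A p (\<omega> p)) \<and>
     (\<forall>c\<in>A. \<forall>e. smooth_on (snd c ` fst c)
        (\<lambda>y. \<omega> (param c y) (chart_vector A c (param c y) e)))"

definition riemannian_metric ::
    "('a, 'n::finite) chart set \<Rightarrow> ('a \<Rightarrow> ('a, 'n) tvec \<Rightarrow> ('a, 'n) tvec \<Rightarrow> real) \<Rightarrow> bool" where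
  "riemannian_metric A g \<longleftrightarrow>
     (\<forall>p. \<forall>v\<in>tangent_space A p.
        tangent_linear A p (g p v) \<and>
        (\<forall>w\<in>tangent_space A p. g p v w = g p w v) \<and>
        (v \<noteq> tzero \<longrightarrow> g p v v > 0)) \<and>
     (\<forall>c\<in>A. \<forall>e e'. smooth_on (snd c ` fst c)
        (\<lambda>y. g (param c y) (chart_vector A c (param c y) e) (chart_vector A c (param c y) e')))"

text \<open>In coordinates \<open>d\<omega>(u, v) = \<Sum>i j. (\<partial>\<^sub>i \<omega>\<^sub>j - \<partial>\<^sub>j \<omega>\<^sub>i) u\<^sub>i v\<^sub>j\<close>. The value does not depend on the
  chart, so any chart around \<open>p\<close> may be chosen.\<close>

definition chart_ext_deriv ::
    "('a, 'n::finite) chart set \<Rightarrow> ('a, 'n) chart \<Rightarrow> ('a \<Rightarrow> ('a, 'n) tvec \<Rightarrow> real)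
     \<Rightarrow> 'a \<Rightarrow> ('a, 'n) tvec \<Rightarrow> ('a, 'n) tvec \<Rightarrow> real" where
  "chart_ext_deriv A c \<omega> p u v =
     frechet_derivative (\<lambda>y. \<omega> (param c y) (chart_vector A c (param c y) (v c)))
       (at (snd c p)) (u c) -
     frechet_derivative (\<lambda>y. \<omega> (param c y) (chart_vector A c (param c y) (u c)))
       (at (snd c p)) (v c)"

definition ext_deriv ::
    "('a, 'n::finite) chart set \<Rightarrow> ('a \<Rightarrow> ('a, 'n) tvec \<Rightarrow> real)
     \<Rightarrow> 'a \<Rightarrow> ('a, 'n) tvec \<Rightarrow> ('a, 'n) tvec \<Rightarrow> real" where
  "ext_deriv A \<omega> p = chart_ext_deriv A (SOME c. c \<in> A \<and> p \<in> fst c) \<omega> p"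

definition wedge_ext_deriv ::
    "('a, 'n::finite) chart set \<Rightarrow> ('a \<Rightarrow> ('a, 'n) tvec \<Rightarrow> real)
     \<Rightarrow> 'a \<Rightarrow> ('a, 'n) tvec \<Rightarrow> ('a, 'n) tvec \<Rightarrow> ('a, 'n) tvec \<Rightarrow> real" where
  \<comment> \<open>the three-form \<open>\<omega> \<and> d\<omega>\<close>\<close>
  "wedge_ext_deriv A \<omega> p u v w =
     \<omega> p u * ext_deriv A \<omega> p v w + \<omega> p v * ext_deriv A \<omega> p w u + \<omega> p w * ext_deriv A \<omega> p u v"

definition kernel_dist ::
    "('a, 'n::finite) chart set \<Rightarrow> ('a \<Rightarrow> ('a, 'n) tvec \<Rightarrow> real) \<Rightarrow> 'a \<Rightarrow> ('a, 'n) tvec set" where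
  "kernel_dist A \<omega> p = {v \<in> tangent_space A p. \<omega> p v = 0}"

definition nowhere_integrable ::
    "('a, 'n::finite) chart set \<Rightarrow> ('a \<Rightarrow> ('a, 'n) tvec \<Rightarrow> real) \<Rightarrow> bool" where
  "nowhere_integrable A \<omega> \<longleftrightarrow> (\<forall>p. \<exists>u\<in>tangent_space A p. \<exists>v\<in>tangent_space A p.
     \<exists>w\<in>tangent_space A p. wedge_ext_deriv A \<omega> p u v w \<noteq> 0)"

definition covector_norm ::
    "('a, 'n::finite) chart set \<Rightarrow> ('a \<Rightarrow> ('a, 'n) tvec \<Rightarrow> ('a, 'n) tvec \<Rightarrow> real)
     \<Rightarrow> ('a \<Rightarrow> ('a, 'n) tvec \<Rightarrow> real) \<Rightarrow> 'a \<Rightarrow> real" where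
  "covector_norm A g \<omega> p = (SUP v\<in>{v \<in> tangent_space A p. g p v v \<le> 1}. \<bar>\<omega> p v\<bar>)"

definition smooth_frame_on ::
    "('a, 'n::finite) chart set \<Rightarrow> ('a \<Rightarrow> ('a, 'n) tvec \<Rightarrow> real) \<Rightarrow> 'a set
     \<Rightarrow> (nat \<Rightarrow> 'a \<Rightarrow> ('a, 'n) tvec) \<Rightarrow> bool" where
  \<comment> \<open>\<open>Y\<^sub>1, \<dots>, Y\<^sub>m\<^sub>-\<^sub>1\<close> is a smooth frame of \<open>ker \<omega>\<close> on \<open>U\<close>\<close>
  "smooth_frame_on A \<omega> U Y \<longleftrightarrow>
     (\<forall>i\<in>{1..CARD('n) - 1}. smooth_vector_field_on A U (Y i)) \<and>
     (\<forall>p\<in>U.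
        (\<forall>i\<in>{1..CARD('n) - 1}. Y i p \<in> kernel_dist A \<omega> p) \<and>
        (\<forall>a. lincomb {1..CARD('n) - 1} a (\<lambda>i. Y i p) = tzero \<longrightarrow>
             (\<forall>i\<in>{1..CARD('n) - 1}. a i = 0)) \<and>
        (\<forall>v\<in>kernel_dist A \<omega> p. \<exists>a. v = lincomb {1..CARD('n) - 1} a (\<lambda>i. Y i p)))"


section \<open>The Sobolev space of curves\<close>

definition abs_cont_on :: "real \<Rightarrow> real \<Rightarrow> (real \<Rightarrow> 'b::real_normed_vector) \<Rightarrow> bool" where
  "abs_cont_on a b h \<longleftrightarrow> (\<forall>\<epsilon>>0. \<exists>\<delta>>0. \<forall>D.
     finite D \<and> (\<forall>(s, t)\<in>D. a \<le> s \<and> s \<le> t \<and> t \<le> b) \<and>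
     pairwise (\<lambda>(s, t) (s', t'). {s<..<t} \<inter> {s'<..<t'} = {}) D \<and>
     (\<Sum>(s, t)\<in>D. t - s) < \<delta>
     \<longrightarrow> (\<Sum>(s, t)\<in>D. norm (h t - h s)) < \<epsilon>)"

text \<open>Curves on \<open>[0, 1]\<close> are extensional functions, i.e. have a fixed dummy value outside.\<close>

definition abs_cont_curve ::
    "('a::topological_space, 'n::finite) chart set \<Rightarrow> (real \<Rightarrow> 'a) \<Rightarrow> bool" where
  "abs_cont_curve A \<sigma> \<longleftrightarrow> \<sigma> \<in> extensional {0..1} \<and> continuous_on {0..1} \<sigma> \<and>
     (\<forall>c\<in>A. \<forall>a b. 0 \<le> a \<and> a \<le> b \<and> b \<le> 1 \<and> \<sigma> ` {a..b} \<subseteq> fst c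
        \<longrightarrow> abs_cont_on a b (snd c \<circ> \<sigma>))"

definition has_velocity ::
    "('a, 'n::finite) chart set \<Rightarrow> (real \<Rightarrow> 'a) \<Rightarrow> ('a, 'n) tvec \<Rightarrow> real \<Rightarrow> bool" where
  "has_velocity A \<sigma> v s \<longleftrightarrow> (\<forall>c\<in>A. \<sigma> s \<in> fst c \<longrightarrow>
     ((snd c \<circ> \<sigma>) has_vector_derivative v c) (at s within {0..1}))"

definition velocity :: "('a, 'n::finite) chart set \<Rightarrow> (real \<Rightarrow> 'a) \<Rightarrow> real \<Rightarrow> ('a, 'n) tvec" where
  \<comment> \<open>arbitrary where \<open>\<sigma>\<close> is not differentiable, a null set for absolutely continuous curves\<close>
  "velocity A \<sigma> s = (\<lambda>c. if c \<in> A \<and> \<sigma> s \<in> fst c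
     then vector_derivative (snd c \<circ> \<sigma>) (at s within {0..1}) else 0)"

definition W12_set ::
    "('a::topological_space, 'n::finite) chart set
     \<Rightarrow> ('a \<Rightarrow> ('a, 'n) tvec \<Rightarrow> ('a, 'n) tvec \<Rightarrow> real)
     \<Rightarrow> 'a \<Rightarrow> 'a \<Rightarrow> (real \<Rightarrow> 'a) set" where
  "W12_set A g x0 x1 = {\<sigma>. abs_cont_curve A \<sigma> \<and> \<sigma> 0 = x0 \<and> \<sigma> 1 = x1 \<and>
     (\<integral>\<^sup>+ s\<in>{0..1}. ennreal (g (\<sigma> s) (velocity A \<sigma> s) (velocity A \<sigma> s)) \<partial>lebesgue) < \<infinity>}"

text \<open>The topology of the Sobolev manifold is generated by the \<open>W\<^sup>1\<^sup>,\<^sup>2\<close>-balls in coordinates: for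
  a curve \<open>\<sigma>\<close> which maps a subinterval \<open>[a, b]\<close> into a chart, the curves which map \<open>[a, b]\<close> into
  the same chart and whose coordinate expression there is at squared \<open>W\<^sup>1\<^sup>,\<^sup>2\<close>-distance less than
  \<open>\<epsilon>\<close> from that of \<open>\<sigma>\<close>. Finite intersections of these sets control the curves on all of \<open>[0, 1]\<close>.\<close>

definition W12_ball ::
    "('a::topological_space, 'n::finite) chart set
     \<Rightarrow> ('a \<Rightarrow> ('a, 'n) tvec \<Rightarrow> ('a, 'n) tvec \<Rightarrow> real)
     \<Rightarrow> 'a \<Rightarrow> 'a \<Rightarrow> ('a, 'n) chart \<Rightarrow> real \<Rightarrow> real \<Rightarrow> (real \<Rightarrow> 'a) \<Rightarrow> real \<Rightarrow> (real \<Rightarrow> 'a) set" where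
  "W12_ball A g x0 x1 c a b \<sigma> \<epsilon> = {\<tau> \<in> W12_set A g x0 x1. \<tau> ` {a..b} \<subseteq> fst c \<and>
     (\<integral>\<^sup>+ s\<in>{a..b}. ennreal ((norm (snd c (\<tau> s) - snd c (\<sigma> s)))\<^sup>2 +
        (norm (velocity A \<tau> s c - velocity A \<sigma> s c))\<^sup>2) \<partial>lebesgue) < ennreal \<epsilon>}"

definition W12 ::
    "('a::topological_space, 'n::finite) chart set
     \<Rightarrow> ('a \<Rightarrow> ('a, 'n) tvec \<Rightarrow> ('a, 'n) tvec \<Rightarrow> real)
     \<Rightarrow> 'a \<Rightarrow> 'a \<Rightarrow> (real \<Rightarrow> 'a) topology" where
  "W12 A g x0 x1 = topology_generated_by {W12_ball A g x0 x1 c a b \<sigma> \<epsilon> | c a b \<sigma> \<epsilon>.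
     c \<in> A \<and> 0 \<le> a \<and> a < b \<and> b \<le> 1 \<and> \<epsilon> > 0 \<and>
     \<sigma> \<in> W12_set A g x0 x1 \<and> \<sigma> ` {a..b} \<subseteq> fst c}"


section \<open>The Randers-Kropina metric and its energy\<close>

text \<open>If \<open>\<Lambda> p = 0\<close> and \<open>\<omega> p v < 0\<close>, the formula reduces to the Kropina metric
  \<open>- g p v v / (2 * \<omega> p v)\<close>. On zero vectors: 0 where \<open>\<Lambda> > 0\<close>, and by convention 1/2 where
  \<open>\<Lambda> = 0\<close>.\<close>

definition randers_kropina ::
    "('a \<Rightarrow> ('a, 'n::finite) tvec \<Rightarrow> ('a, 'n) tvec \<Rightarrow> real) \<Rightarrow> ('a \<Rightarrow> ('a, 'n) tvec \<Rightarrow> real)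
     \<Rightarrow> ('a \<Rightarrow> real) \<Rightarrow> 'a \<Rightarrow> ('a, 'n) tvec \<Rightarrow> real" where
  "randers_kropina g \<omega> \<Lambda> p v =
     (if v = tzero then (if \<Lambda> p = 0 then 1/2 else 0)
      else if \<Lambda> p > 0 \<or> \<omega> p v < 0
        then g p v v / (- \<omega> p v + sqrt (\<Lambda> p * g p v v + (\<omega> p v)\<^sup>2))
      else undefined)"

definition energy ::
    "('a, 'n::finite) chart set \<Rightarrow> ('a \<Rightarrow> ('a, 'n) tvec \<Rightarrow> ('a, 'n) tvec \<Rightarrow> real)
     \<Rightarrow> ('a \<Rightarrow> ('a, 'n) tvec \<Rightarrow> real) \<Rightarrow> ('a \<Rightarrow> real) \<Rightarrow> (real \<Rightarrow> 'a) \<Rightarrow> ennreal" where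
  "energy A g \<omega> \<Lambda> \<sigma> = ennreal (1/2) *
     (\<integral>\<^sup>+ s\<in>{0..1}. ennreal ((randers_kropina g \<omega> \<Lambda> (\<sigma> s) (velocity A \<sigma> s))\<^sup>2) \<partial>lebesgue)"


section \<open>The control system\<close>

definition admissible_controls :: "nat \<Rightarrow> real \<Rightarrow> (real \<Rightarrow> nat \<Rightarrow> real) set" where
  "admissible_controls d C = {u.
     (\<forall>i\<le>d. (\<lambda>s. u s i) \<in> borel_measurable (lebesgue_on {0..1})) \<and>
     (\<exists>P. finite P \<and> partition_on {0..1} P \<and> (\<forall>J\<in>P. is_interval J) \<and>
        (\<forall>J\<in>P. \<exists>\<xi>\<ge>0. \<exists>\<alpha>.
           (\<forall>i\<in>{1..d}. \<alpha> i \<in> borel_measurable (lebesgue_on J)) \<and>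
           (\<forall>s\<in>J. (\<Sum>i=1..d. (\<alpha> i s)\<^sup>2) \<le> C\<^sup>2) \<and>
           (\<forall>s\<in>J. u s 0 = \<xi>\<^sup>2 \<and> (\<forall>i\<in>{1..d}. u s i = \<xi> * \<alpha> i s))))}"

definition control_solution ::
    "('a::topological_space, 'n::finite) chart set \<Rightarrow> nat \<Rightarrow> (nat \<Rightarrow> 'a \<Rightarrow> ('a, 'n) tvec) \<Rightarrow> 'a
     \<Rightarrow> (real \<Rightarrow> nat \<Rightarrow> real) \<Rightarrow> (real \<Rightarrow> 'a) \<Rightarrow> bool" where
  "control_solution A d X x0 u \<sigma> \<longleftrightarrow> abs_cont_curve A \<sigma> \<and> \<sigma> 0 = x0 \<and>
     (AE s in lebesgue_on {0..1}. has_velocity A \<sigma> (lincomb {0..d} (u s) (\<lambda>i. X i (\<sigma> s))) s)"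

definition Omega_set ::
    "('a::topological_space, 'n::finite) chart set \<Rightarrow> nat \<Rightarrow> (nat \<Rightarrow> 'a \<Rightarrow> ('a, 'n) tvec) \<Rightarrow> real
     \<Rightarrow> 'a \<Rightarrow> 'a \<Rightarrow> (real \<Rightarrow> 'a) set" where
  "Omega_set A d X C x0 x1 =
     {\<sigma>. \<sigma> 1 = x1 \<and> (\<exists>u\<in>admissible_controls d C. control_solution A d X x0 u \<sigma>)}"

definition Omega12 ::
    "('a::topological_space, 'n::finite) chart set
     \<Rightarrow> ('a \<Rightarrow> ('a, 'n) tvec \<Rightarrow> ('a, 'n) tvec \<Rightarrow> real)
     \<Rightarrow> nat \<Rightarrow> (nat \<Rightarrow> 'a \<Rightarrow> ('a, 'n) tvec) \<Rightarrow> real \<Rightarrow> 'a \<Rightarrow> 'a \<Rightarrow> (real \<Rightarrow> 'a) topology" where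
  "Omega12 A g d X C x0 x1 = subtopology (W12 A g x0 x1) (Omega_set A d X C x0 x1)"

definition homotopy_inverse ::
    "'b topology \<Rightarrow> 'c topology \<Rightarrow> ('b \<Rightarrow> 'c) \<Rightarrow> ('c \<Rightarrow> 'b) \<Rightarrow> bool" where
  "homotopy_inverse T T' j f \<longleftrightarrow> continuous_map T T' j \<and> continuous_map T' T f \<and>
     homotopic_with (\<lambda>_. True) T T (f \<circ> j) id \<and>
     homotopic_with (\<lambda>_. True) T' T' (j \<circ> f) id"

end

(* On a curve solving the control system with u_0 = xi^2 and u_i = xi alpha_i, the transversal and
   horizontal parts of the velocity are balanced so that F^2 <= 1/4 + (g_0(v, v) + C^4) / (2 n^2),
   where n is the norm of omega. Hence it suffices to bound the integral of g_0(v, v) from above and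
   n from below. Both are possible near a given curve of f(K): in charts, W^{1,2}-closeness implies
   uniform closeness and L^2-closeness of the velocities. The curves of f(K) solve the control
   system, so they are differentiable almost everywhere by definition. Compactness of f(K) turns the
   local bounds into a global one. *)

theory Submission
  imports Defs
begin

text \<open>The obstacle is that \<open>g\<close> alone does not control \<open>F\<close>: where
  \<open>\<Lambda>\<close> vanishes, \<open>F\<close> blows up on unit vectors approaching the
  kernel of \<open>\<omega>\<close>. The coupling of the controls through one \<open>\<xi>\<close>
  repairs this. The horizontal part w of the velocity v satisfies g(w, w) \<le> C^2 \<xi>^2, while
  -\<omega>(v) = \<xi>^2 n, so a factor \<xi>^2 cancels and F \<le> (\<xi>^2 + C^2) / (2 n).
  Squaring and using \<xi>^4 \<le> g(v, v) gives the stated bound; its 1/4 is the square of the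
  conventional value of \<open>F\<close> at a zero vector. The neighbourhoods exploit an asymmetry.
  The constants in the bound for \<open>F\<close> depend only on a compact coordinate ball and serve
  all curves at once, whereas the essential bound on the speed belongs to the central curve alone:
  its control has finitely many pieces, each with a constant \<xi>. Nearby curves differ from it by
  a velocity that is small in L^2. That they stay in the ball follows from the fundamental theorem
  of calculus for absolutely continuous functions, applied to differences of coordinate
  expressions.\<close>

section \<open>Absolutely continuous functions: fundamental theorem and Sobolev estimate\<close>

text \<open>Translates between two formats: absolute continuity speaks of disjoint open intervals,
  the gauge integral of tagged pieces. Pieces of a division have disjoint interiors, and their
  lengths add up to the measure of their union, so their endpoint pairs form an admissible family
  \<open>D\<close>.\<close>

lemma abs_cont_on_tagged_partial_division:
  fixes h :: "real \<Rightarrow> 'b::real_normed_vector"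
  assumes "abs_cont_on a b h" "e > 0"
  obtains \<delta> where "\<delta> > 0"
    "\<And>p. p tagged_partial_division_of {a..b} \<Longrightarrow> measure lebesgue (\<Union>(snd ` p)) < \<delta>
       \<Longrightarrow> (\<Sum>(x, K)\<in>p. norm (h (Sup K) - h (Inf K))) < e"
proof -
  obtain \<delta> where \<delta>: "\<delta> > 0" and *: "\<And>D. finite D \<Longrightarrow> (\<forall>(s, t)\<in>D. a \<le> s \<and> s \<le> t \<and> t \<le> b) \<Longrightarrow>
     pairwise (\<lambda>(s, t) (s', t'). {s<..<t} \<inter> {s'<..<t'} = {}) D \<Longrightarrow>
     (\<Sum>(s, t)\<in>D. t - s) < \<delta> \<Longrightarrow> (\<Sum>(s, t)\<in>D. norm (h t - h s)) < e"
    using assms unfolding abs_cont_on_def by meson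
  show ?thesis
  proof (rule that[OF \<delta>])
    fix p assume p: "p tagged_partial_division_of {a..b}" and m: "measure lebesgue (\<Union>(snd ` p)) < \<delta>"
    define \<D> where "\<D> = snd ` p"
    have pt: "p tagged_division_of (\<Union>\<D>)"
      unfolding \<D>_def by (rule tagged_partial_division_of_Union_self[OF p])
    have div: "\<D> division_of (\<Union>\<D>)"
      unfolding \<D>_def using division_of_tagged_division[OF pt] by (simp add: \<D>_def)
    define \<D>' where "\<D>' = {K\<in>\<D>. measure lborel K \<noteq> 0}"
    have fin: "finite \<D>'" using div by (auto simp: \<D>'_def)
    have K: "K \<in> \<D> \<Longrightarrow> \<exists>u v. K = {u..v} \<and> u \<le> v \<and> a \<le> u \<and> v \<le> b" for K
    proof -
      assume "K \<in> \<D>"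
      then obtain x where "(x, K) \<in> p" by (auto simp: \<D>_def)
      with tagged_partial_division_ofD(2,3,4)[OF p this] obtain u v where
        "K = {u..v}" "x \<in> K" "K \<subseteq> {a..b}" by (metis box_real(2))
      then show ?thesis by (intro exI[of _ u] exI[of _ v]) auto
    qed
    \<comment> \<open>Passing from tagged pairs to pieces asks for a summand that vanishes on every
      interval with empty interior, including the empty one, about whose \<open>Sup\<close> and
      \<open>Inf\<close> nothing is known.\<close>
    define d where "d K = (if measure lborel K = 0 then 0 else norm (h (Sup K) - h (Inf K)))" for K :: "real set"
    define D where "D = (\<lambda>K. (Inf K, Sup K)) ` \<D>'"
    have K': "Inf K < Sup K" "a \<le> Inf K" "Sup K \<le> b" "K = {Inf K..Sup K}"
      "measure lborel K = Sup K - Inf K" if "K \<in> \<D>'" for K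
    proof -
      have "K \<in> \<D>" "measure lborel K \<noteq> 0" using that by (auto simp: \<D>'_def)
      with K obtain u v where uv: "K = {u..v}" "u \<le> v" "a \<le> u" "v \<le> b" by blast
      moreover have "u \<noteq> v" using uv \<open>measure lborel K \<noteq> 0\<close> by auto
      ultimately show "Inf K < Sup K" "a \<le> Inf K" "Sup K \<le> b" "K = {Inf K..Sup K}"
        "measure lborel K = Sup K - Inf K" by auto
    qed
    have inj: "inj_on (\<lambda>K. (Inf K, Sup K)) \<D>'"
    proof (rule inj_onI)
      fix L M assume "L \<in> \<D>'" "M \<in> \<D>'" "(Inf L, Sup L) = (Inf M, Sup M)"
      then show "L = M" using K'(4)[of L] K'(4)[of M] by (metis prod.inject)
    qed
    have "(\<Sum>(x, K)\<in>p. norm (h (Sup K) - h (Inf K))) = (\<Sum>(x, K)\<in>p. d K)"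
    proof (rule sum.cong[OF refl], clarify)
      fix x L assume "(x, L) \<in> p"
      then have "L \<in> \<D>" by (force simp: \<D>_def)
      with K obtain u v where "L = {u..v}" "u \<le> v" by blast
      then show "norm (h (Sup L) - h (Inf L)) = d L" by (auto simp: d_def content_real_eq_0)
    qed
    also have "\<dots> = (\<Sum>K\<in>\<D>. d K)"
      unfolding \<D>_def by (rule sum.over_tagged_division_lemma[OF pt]) (simp add: d_def content_eq_0_interior)
    also have "\<dots> = (\<Sum>K\<in>\<D>'. d K)"
      unfolding \<D>'_def using div by (intro sum.mono_neutral_right) (auto simp: d_def)
    also have "\<dots> = (\<Sum>(s, t)\<in>D. norm (h t - h s))"
      unfolding D_def by (subst sum.reindex[OF inj]) (auto simp: d_def \<D>'_def intro!: sum.cong)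
    also have "\<dots> < e"
    proof (rule *)
      show "finite D" using fin by (simp add: D_def)
      show "\<forall>(s, t)\<in>D. a \<le> s \<and> s \<le> t \<and> t \<le> b" unfolding D_def using K' by (auto intro: less_imp_le)
      show "pairwise (\<lambda>(s, t) (s', t'). {s<..<t} \<inter> {s'<..<t'} = {}) D"
        unfolding D_def pairwise_image
      proof (rule pairwiseI, unfold split_conv, rule impI)
        fix L M assume LM: "L \<in> \<D>'" "M \<in> \<D>'" "L \<noteq> M"
        then have "interior L \<inter> interior M = {}"
          using division_ofD(5)[OF div] by (auto simp: \<D>'_def)
        moreover have "interior L = {Inf L<..<Sup L}" "interior M = {Inf M<..<Sup M}"
          using arg_cong[where f=interior, OF K'(4)[OF LM(1)]] arg_cong[where f=interior, OF K'(4)[OF LM(2)]]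
          by simp_all
        ultimately show "{Inf L<..<Sup L} \<inter> {Inf M<..<Sup M} = {}" by simp
      qed
      have "(\<Sum>(s, t)\<in>D. t - s) = (\<Sum>K\<in>\<D>'. measure lborel K)"
        unfolding D_def by (subst sum.reindex[OF inj]) (auto simp: K'(5) intro!: sum.cong)
      also have "\<dots> = (\<Sum>K\<in>\<D>. measure lborel K)"
        unfolding \<D>'_def using div by (intro sum.mono_neutral_left) auto
      also have "\<dots> = measure lebesgue (\<Union>\<D>)"
        unfolding content_division[OF div, symmetric] 
      proof (intro sum.cong refl)
        fix L assume "L \<in> \<D>"
        then obtain u v where "L = {u..v}" "u \<le> v" using K by blast
        then show "measure lborel L = measure lebesgue L" by simp
      qed
      finally show "(\<Sum>(s, t)\<in>D. t - s) < \<delta>" using m by (simp add: \<D>_def)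
    qed
    finally show "(\<Sum>(x, K)\<in>p. norm (h (Sup K) - h (Inf K))) < e" .
  qed
qed

text \<open>With the gauge integral, integrability of \<open>h'\<close> is part of the conclusion.
  Tags outside \<open>N\<close> are handled by the definition of the derivative. Pieces with tags in
  \<open>N\<close> lie in an open set of measure less than \<open>\<delta>\<close>, so absolute
  continuity makes the increments of \<open>h\<close> over them sum to less than
  \<open>e / 2\<close>.\<close>

theorem fundamental_theorem_of_calculus_abs_cont:
  fixes h :: "real \<Rightarrow> 'b::banach"
  assumes "a \<le> b" and ac: "abs_cont_on a b h" and N: "negligible N"
    and der: "\<And>s. s \<in> {a..b} - N \<Longrightarrow> (h has_vector_derivative h' s) (at s within {a..b})"
  shows "(h' has_integral (h b - h a)) {a..b}"
proof -
  \<comment> \<open>With value 0 on \<open>N\<close>, a tag in \<open>N\<close> contributes nothing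
    but the increment of \<open>h\<close>.\<close>
  define k where "k s = (if s \<in> N then 0 else h' s)" for s

  have "(k has_integral (h b - h a)) {a..b}"
    unfolding has_integral_real
  proof (intro allI impI)
    fix e :: real assume "e > 0"
    \<comment> \<open>The \<open>+ 1\<close> keeps the denominator positive when
      \<open>a = b\<close>.\<close>
    define e' where "e' = e / (2 * (b - a + 1))"
    have e': "e' > 0" "e' * (b - a) \<le> e/2"
      using \<open>e > 0\<close> \<open>a \<le> b\<close> by (auto simp: e'_def field_simps)
    obtain \<delta> where \<delta>: "\<delta> > 0" and ac': "\<And>p. p tagged_partial_division_of {a..b} \<Longrightarrow> 
        measure lebesgue (\<Union>(snd ` p)) < \<delta> \<Longrightarrow> (\<Sum>(x, K)\<in>p. norm (h (Sup K) - h (Inf K))) < e/2"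
      using abs_cont_on_tagged_partial_division[OF ac half_gt_zero[OF \<open>e > 0\<close>]] by blast
    have N': "N \<in> null_sets lebesgue" using N by (simp add: negligible_iff_null_sets)
    then obtain T where T: "open T" "N \<subseteq> T" "emeasure lebesgue (T - N) < ennreal \<delta>" "T - N \<in> lmeasurable"
      using sets_lebesgue_outer_open[of N \<delta>] \<delta> by (metis null_setsD2)
    have Tm: "T \<in> lmeasurable" "measure lebesgue T < \<delta>"
    proof -
      have "emeasure lebesgue (T - N) = emeasure lebesgue T" 
        using N' T by (intro emeasure_Diff_null_set) (auto)
      then have "emeasure lebesgue T < ennreal \<delta>" using T by simp
      then show "T \<in> lmeasurable" using T(1) 
        by (intro fmeasurableI) (auto simp: infinity_ennreal_def intro: order.strict_trans[OF _ ennreal_less_top])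
      then show "measure lebesgue T < \<delta>" using \<open>emeasure lebesgue T < ennreal \<delta>\<close> \<delta>
        by (metis emeasure_eq_measure2 ennreal_less_iff measure_nonneg)
    qed
    have "\<forall>s. \<exists>d>0. s \<in> {a..b} - N \<longrightarrow>
         (\<forall>y\<in>{a..b}. norm (y-s) < d \<longrightarrow> norm (h y - h s - (y-s) *\<^sub>R h' s) \<le> e' * norm (y-s))"
      using der[unfolded has_vector_derivative_def has_derivative_within_alt] e'(1)
      by (metis zero_less_one)
    then obtain d where d0: "\<And>s. 0 < d s"
      and d: "\<And>s y. s \<in> {a..b} - N \<Longrightarrow> y \<in> {a..b} \<Longrightarrow> norm (y-s) < d s \<Longrightarrow>
                norm (h y - h s - (y-s) *\<^sub>R h' s) \<le> e' * norm (y-s)"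
      by metis
    define \<gamma> where "\<gamma> s = (if s \<in> N then T else ball s (d s))" for s
    show "\<exists>\<gamma>. gauge \<gamma> \<and> (\<forall>\<D>. \<D> tagged_division_of {a..b} \<and> \<gamma> fine \<D> \<longrightarrow>
        norm ((\<Sum>(x,K)\<in>\<D>. measure lborel K *\<^sub>R k x) - (h b - h a)) < e)"
    proof (intro exI[of _ \<gamma>] conjI allI impI)
      show "gauge \<gamma>" unfolding gauge_def \<gamma>_def using T d0 by auto
      fix p assume p: "p tagged_division_of {a..b} \<and> \<gamma> fine p"
      define p1 where "p1 = {(x, K)\<in>p. x \<notin> N}"
      define p2 where "p2 = {(x, K)\<in>p. x \<in> N}"
      have fin: "finite p" using p by blast
      have p12: "p = p1 \<union> p2" "p1 \<inter> p2 = {}" by (auto simp: p1_def p2_def)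
      have K: "(x, K) \<in> p \<Longrightarrow> \<exists>u v. K = {u..v} \<and> u \<le> v \<and> a \<le> u \<and> v \<le> b \<and> x \<in> K \<and> K \<subseteq> \<gamma> x" for x K
      proof -
        assume xK: "(x, K) \<in> p"
        have "p tagged_division_of {a..b}" using p by blast
        from tagged_division_ofD(2-4)[OF this xK] obtain u v where
          "K = {u..v}" "x \<in> K" "K \<subseteq> {a..b}" by (metis box_real(2))
        moreover have "K \<subseteq> \<gamma> x" using p xK by (auto simp: fine_def)
        ultimately show ?thesis by (intro exI[of _ u] exI[of _ v]) auto
      qed
      have hh: "h b - h a = (\<Sum>(x,K)\<in>p. h (Sup K) - h (Inf K))"
        and ba: "b - a = (\<Sum>(x,K)\<in>p. Sup K - Inf K)"
        using additive_tagged_division_1[OF \<open>a \<le> b\<close>, of p h] additive_tagged_division_1[OF \<open>a \<le> b\<close>, of p "\<lambda>x. x"] p by auto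
      have S1: "norm (measure lborel K *\<^sub>R k x - (h (Sup K) - h (Inf K))) \<le> e' * (Sup K - Inf K)"
        if xK: "(x, K) \<in> p" "x \<notin> N" for x K
      proof -
        obtain u v where uv: "K = {u..v}" "u \<le> v" "a \<le> u" "v \<le> b" "x \<in> K" "K \<subseteq> ball x (d x)"
          using K[OF xK(1)] xK(2) by (auto simp: \<gamma>_def)
        have x: "x \<in> {a..b} - N" using uv that by auto
        have "u \<in> K" "v \<in> K" using uv by auto
        then have u: "u \<in> ball x (d x)" "v \<in> ball x (d x)" using uv(6) by blast+
        have 1: "norm (h u - h x - (u-x) *\<^sub>R h' x) \<le> e' * norm (u-x)"
          by (rule d[OF x]) (use uv u in \<open>auto simp: dist_real_def\<close>)
        have 2: "norm (h v - h x - (v-x) *\<^sub>R h' x) \<le> e' * norm (v-x)"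
          by (rule d[OF x]) (use uv u in \<open>auto simp: dist_real_def\<close>)
        \<comment> \<open>Both endpoints are compared with the tag. Since \<open>x\<close> lies
          between them, the two errors add up to \<open>e'\<close> times the length of the
          piece.\<close>
        have "measure lborel K *\<^sub>R k x - (h (Sup K) - h (Inf K)) =
            (h u - h x - (u-x) *\<^sub>R h' x) - (h v - h x - (v-x) *\<^sub>R h' x)"
          using uv that by (simp add: k_def algebra_simps)
        also have "norm \<dots> \<le> e' * norm (u-x) + e' * norm (v-x)"
          using norm_triangle_ineq4 1 2 by (meson add_mono order_trans)
        also have "\<dots> = e' * (Sup K - Inf K)" using uv by (simp add: algebra_simps)
        finally show ?thesis .
      qed
      have "norm (\<Sum>(x,K)\<in>p1. measure lborel K *\<^sub>R k x - (h (Sup K) - h (Inf K))) \<le>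
              (\<Sum>(x,K)\<in>p1. e' * (Sup K - Inf K))"
        by (rule sum_norm_le) (use S1 in \<open>auto simp: p1_def\<close>)
      also have "\<dots> \<le> (\<Sum>(x,K)\<in>p. e' * (Sup K - Inf K))"
      proof (rule sum_mono2[OF fin], simp add: p12(1), clarify)
        fix x L assume "(x, L) \<in> p"
        then obtain u v where "L = {u..v}" "u \<le> v" using K by blast
        then show "0 \<le> e' * (Sup L - Inf L)" using e' by simp
      qed
      also have "\<dots> = e' * (b - a)" by (simp add: ba sum_distrib_left split_def)
      finally have 1: "norm (\<Sum>(x,K)\<in>p1. measure lborel K *\<^sub>R k x - (h (Sup K) - h (Inf K))) \<le> e/2"
        using e' by simp
      have p2: "p2 tagged_partial_division_of {a..b}"
        by (rule tagged_partial_division_subset[of p]) 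
           (use p in \<open>auto simp: tagged_division_of_def p2_def\<close>)
      have "(\<Sum>(x, K)\<in>p2. norm (h (Sup K) - h (Inf K))) < e/2"
      proof (rule ac'[OF p2])
        have "measure lebesgue (\<Union>(snd ` p2)) \<le> measure lebesgue T"
        proof (rule measure_mono_fmeasurable[OF _ _ Tm(1)])
          show "\<Union>(snd ` p2) \<subseteq> T" 
          proof clarsimp
            fix y x L assume "(x, L) \<in> p2" "y \<in> L"
            then have "L \<subseteq> \<gamma> x" "x \<in> N" using K[of x L] by (auto simp: p2_def)
            then show "y \<in> T" using \<open>y \<in> L\<close> by (auto simp: \<gamma>_def)
          qed

          show "\<Union>(snd ` p2) \<in> sets lebesgue"
          proof (rule sets.finite_Union)
            show "finite (snd ` p2)" using fin by (simp add: p12(1))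
            show "snd ` p2 \<subseteq> sets lebesgue"
            proof clarsimp
              fix x L assume "(x, L) \<in> p2"
              then obtain u v where "L = {u..v}" using K[of x L] by (auto simp: p2_def)
              then show "L \<in> sets lebesgue" by simp
            qed
          qed
        qed
        then show "measure lebesgue (\<Union>(snd ` p2)) < \<delta>" using Tm by simp
      qed
      moreover have "norm (\<Sum>(x,K)\<in>p2. measure lborel K *\<^sub>R k x - (h (Sup K) - h (Inf K)))
          \<le> (\<Sum>(x, K)\<in>p2. norm (h (Sup K) - h (Inf K)))"
        by (rule sum_norm_le) (auto simp: p2_def k_def norm_minus_commute)
      ultimately have 2: "norm (\<Sum>(x,K)\<in>p2. measure lborel K *\<^sub>R k x - (h (Sup K) - h (Inf K))) < e/2"
        by simp
      have "(\<Sum>(x,K)\<in>p. measure lborel K *\<^sub>R k x) - (h b - h a)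
          = (\<Sum>(x,K)\<in>p. measure lborel K *\<^sub>R k x - (h (Sup K) - h (Inf K)))"
        by (simp add: hh split_def sum_subtractf)
      also have "\<dots> = (\<Sum>(x,K)\<in>p1. measure lborel K *\<^sub>R k x - (h (Sup K) - h (Inf K)))
          + (\<Sum>(x,K)\<in>p2. measure lborel K *\<^sub>R k x - (h (Sup K) - h (Inf K)))"
        unfolding p12(1) by (rule sum.union_disjoint) (use fin p12 in auto)
      finally show "norm ((\<Sum>(x,K)\<in>p. measure lborel K *\<^sub>R k x) - (h b - h a)) < e"
        using 1 2 by (metis (no_types, lifting) add_le_less_mono field_sum_of_halves norm_triangle_lt)
    qed
  qed
  then show ?thesis
    by (rule has_integral_spike[OF N, rotated]) (simp add: k_def)
qed

lemma abs_cont_on_subset: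
  assumes "abs_cont_on a b h" "a \<le> a'" "b' \<le> b"
  shows "abs_cont_on a' b' h"
  unfolding abs_cont_on_def
proof (intro allI impI)
  fix e :: real assume "e > 0"
  with assms(1) obtain \<delta> where \<delta>: "\<delta> > 0" "\<And>D. finite D \<and> (\<forall>(s, t)\<in>D. a \<le> s \<and> s \<le> t \<and> t \<le> b) \<and>
     pairwise (\<lambda>(s, t) (s', t'). {s<..<t} \<inter> {s'<..<t'} = {}) D \<and>
     (\<Sum>(s, t)\<in>D. t - s) < \<delta> \<Longrightarrow> (\<Sum>(s, t)\<in>D. norm (h t - h s)) < e"
    unfolding abs_cont_on_def by meson
  show "\<exists>\<delta>>0. \<forall>D. finite D \<and> (\<forall>(s, t)\<in>D. a' \<le> s \<and> s \<le> t \<and> t \<le> b') \<and>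
     pairwise (\<lambda>(s, t) (s', t'). {s<..<t} \<inter> {s'<..<t'} = {}) D \<and>
     (\<Sum>(s, t)\<in>D. t - s) < \<delta> \<longrightarrow> (\<Sum>(s, t)\<in>D. norm (h t - h s)) < e"
    by (intro exI[of _ \<delta>] conjI \<delta> allI impI) (use assms(2,3) in \<open>fastforce+\<close>)
qed

lemma abs_cont_on_diff:
  fixes f h :: "real \<Rightarrow> 'b::real_normed_vector"
  assumes "abs_cont_on a b f" "abs_cont_on a b h"
  shows "abs_cont_on a b (\<lambda>s. f s - h s)"
  unfolding abs_cont_on_def
proof (intro allI impI)
  fix e :: real assume "e > 0"
  then have "e/2 > 0" by simp
  let ?P = "\<lambda>D \<delta>. finite D \<and> (\<forall>(s, t)\<in>D. a \<le> s \<and> s \<le> t \<and> t \<le> b) \<and>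
     pairwise (\<lambda>(s, t) (s', t'). {s<..<t} \<inter> {s'<..<t'} = {}) D \<and> (\<Sum>(s, t)\<in>D. t - s) < \<delta>"
  obtain \<delta>1 where 1: "\<delta>1 > 0" "\<And>D. ?P D \<delta>1 \<Longrightarrow> (\<Sum>(s, t)\<in>D. norm (f t - f s)) < e/2"
    using assms(1) \<open>e/2 > 0\<close> unfolding abs_cont_on_def by meson
  obtain \<delta>2 where 2: "\<delta>2 > 0" "\<And>D. ?P D \<delta>2 \<Longrightarrow> (\<Sum>(s, t)\<in>D. norm (h t - h s)) < e/2"
    using assms(2) \<open>e/2 > 0\<close> unfolding abs_cont_on_def by meson
  show "\<exists>\<delta>>0. \<forall>D. ?P D \<delta> \<longrightarrow> (\<Sum>(s, t)\<in>D. norm (f t - h t - (f s - h s))) < e"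
  proof (intro exI[of _ "min \<delta>1 \<delta>2"] conjI allI impI)
    fix D assume D: "?P D (min \<delta>1 \<delta>2)"
    have "(\<Sum>(s, t)\<in>D. norm (f t - h t - (f s - h s))) \<le> (\<Sum>(s, t)\<in>D. norm (f t - f s) + norm (h t - h s))"
    proof (rule sum_mono, clarify)
      fix s t
      have "f t - h t - (f s - h s) = (f t - f s) - (h t - h s)" by simp
      then show "norm (f t - h t - (f s - h s)) \<le> norm (f t - f s) + norm (h t - h s)"
        by (metis norm_triangle_ineq4)
    qed
    also have "\<dots> = (\<Sum>(s, t)\<in>D. norm (f t - f s)) + (\<Sum>(s, t)\<in>D. norm (h t - h s))"
      by (simp add: split_def sum.distrib)
    also have "\<dots> < e/2 + e/2"
      by (rule add_strict_mono; rule 1 2) (use D in auto)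
    finally show "(\<Sum>(s, t)\<in>D. norm (f t - h t - (f s - h s))) < e" by simp
  qed (use 1 2 in auto)
qed

text \<open>The one-dimensional Sobolev embedding: the oscillation of \<open>h\<close> is at most \<open>r / 2\<close>, since
  \<open>norm (k s) \<le> (r / 2 + (norm (k s))\<^sup>2 / (r / 2)) / 2\<close>, and if \<open>norm (h t) \<ge> r\<close> at some point, then
  \<open>norm h \<ge> r / 2\<close> everywhere, which contradicts the smallness of the integral.\<close>

lemma abs_cont_on_W12_small:
  fixes h k :: "real \<Rightarrow> 'b::euclidean_space"
  assumes ab: "a < b" "b - a \<le> 1" and r: "r > 0"
    and ac: "abs_cont_on a b h"
    and der: "AE s in lebesgue_on {a..b}. (h has_vector_derivative k s) (at s within {a..b})"
    and small: "(\<integral>\<^sup>+ s\<in>{a..b}. ennreal ((norm (h s))\<^sup>2 + (norm (k s))\<^sup>2) \<partial>lebesgue)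
        < ennreal (r\<^sup>2 / 4 * (b - a))"
  shows "k \<in> borel_measurable (lebesgue_on {a..b})"
    and "\<And>t. t \<in> {a..b} \<Longrightarrow> norm (h t) < r"
proof -
  define N where "N = {s\<in>{a..b}. \<not> (h has_vector_derivative k s) (at s within {a..b})}"
  have "AE s in lebesgue. s \<notin> N"
    using der by (subst (asm) AE_restrict_space_iff) (auto simp: N_def)
  then have N: "negligible N"
    unfolding negligible_iff_null_sets by (simp add: completion.null_sets_iff_AE)
  have ftc: "(k has_integral (h t - h s)) {s..t}" if "a \<le> s" "s \<le> t" "t \<le> b" for s t
  proof (rule fundamental_theorem_of_calculus_abs_cont[OF that(2) _ N])
    show "abs_cont_on s t h" by (rule abs_cont_on_subset[OF ac]) (use that in auto)
    fix x assume "x \<in> {s..t} - N"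
    then have "x \<in> {a..b} - N" using that by auto
    then have "(h has_vector_derivative k x) (at x within {a..b})" by (auto simp: N_def)
    then show "(h has_vector_derivative k x) (at x within {s..t})"
      by (rule has_vector_derivative_within_subset) (use that in auto)
  qed
  \<comment> \<open>Measurability of \<open>k\<close> is not assumed; it comes out of the
    integrability supplied by the fundamental theorem.\<close>
  show k: "k \<in> borel_measurable (lebesgue_on {a..b})"
    by (rule integrable_imp_measurable) (use ftc[of a b] ab in auto)
  define \<eta> where "\<eta> = r / 2"
  have \<eta>: "\<eta> > 0" "r\<^sup>2 / 4 = \<eta>\<^sup>2" using r by (auto simp: \<eta>_def power2_eq_square)
  let ?k2 = "\<lambda>s. (norm (k s))\<^sup>2"
  have k2m: "?k2 \<in> borel_measurable (lebesgue_on {a..b})" using k by measurable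
  have "(\<integral>\<^sup>+ s. ennreal (?k2 s) \<partial>lebesgue_on {a..b}) = (\<integral>\<^sup>+ s\<in>{a..b}. ennreal (?k2 s) \<partial>lebesgue)"
    by (subst nn_integral_restrict_space) auto
  also have "\<dots> \<le> (\<integral>\<^sup>+ s\<in>{a..b}. ennreal ((norm (h s))\<^sup>2 + (norm (k s))\<^sup>2) \<partial>lebesgue)"
    by (intro nn_integral_mono mult_right_mono ennreal_leI) auto
  finally have k2: "(\<integral>\<^sup>+ s. ennreal (?k2 s) \<partial>lebesgue_on {a..b}) < ennreal (\<eta>\<^sup>2 * (b - a))"
    using small \<eta>(2) by simp
  have k2i: "integrable (lebesgue_on {a..b}) ?k2"
    by (rule integrableI_nonneg[OF k2m]) (use k2 in \<open>auto intro: order.strict_trans[OF _ ennreal_less_top]\<close>)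
  then have k2I: "integral\<^sup>L (lebesgue_on {a..b}) ?k2 \<le> \<eta>\<^sup>2 * (b - a)"
    using k2 ab by (subst (asm) nn_integral_eq_integral) (auto simp: ennreal_less_iff)
  have k2h: "(?k2 has_integral integral\<^sup>L (lebesgue_on {a..b}) ?k2) {a..b}"
    by (rule has_integral_integral_lebesgue_on[OF k2i]) auto
  \<comment> \<open>The weight \<open>\<eta>\<close> balances the two terms: as the integral of
    \<open>?k2\<close> is at most \<open>\<eta>\<^sup>2 * (b - a)\<close>, that of
    \<open>\<phi>\<close> is at most \<open>\<eta> * (b - a)\<close>, hence at most
    \<open>\<eta>\<close>.\<close>
  define \<phi> where "\<phi> s = (\<eta> + ?k2 s / \<eta>) / 2" for s
  have \<phi>I: "(\<phi> has_integral (\<eta> * (b - a) + integral\<^sup>L (lebesgue_on {a..b}) ?k2 / \<eta>) / 2) {a..b}"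
    unfolding \<phi>_def using ab has_integral_const_real[of \<eta> a b]
    by (intro has_integral_divide has_integral_add k2h) (auto simp: mult.commute)
  have \<phi>0: "0 \<le> \<phi> s" for s using \<eta> by (simp add: \<phi>_def)
  have osc: "norm (h t - h s) \<le> \<eta>" if st: "a \<le> s" "s \<le> t" "t \<le> b" for s t
  proof -
    have \<phi>st: "\<phi> integrable_on {s..t}"
      by (rule integrable_on_subinterval[of _ "{a..b}"]) (use \<phi>I st in \<open>auto simp: integrable_on_def\<close>)
    have "norm (k x) \<le> \<phi> x" for x
    proof -
      have "0 \<le> (norm (k x) - \<eta>)\<^sup>2" by simp
      then have "2 * \<eta> * norm (k x) \<le> \<eta>\<^sup>2 + ?k2 x" by (simp add: power2_diff algebra_simps)
      then show ?thesis using \<eta> by (simp add: \<phi>_def field_simps power2_eq_square)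
    qed
    then have "norm (integral {s..t} k) \<le> integral {s..t} \<phi>"
      by (intro integral_norm_bound_integral \<phi>st) (use ftc[OF st] in auto)
    then have "norm (h t - h s) \<le> integral {s..t} \<phi>"
      using integral_unique[OF ftc[OF st]] by simp
    also have "\<dots> \<le> integral {a..b} \<phi>"
      by (rule integral_subset_le) (use \<phi>st \<phi>I st \<phi>0 in auto)
    also have "\<dots> = (\<eta> * (b - a) + integral\<^sup>L (lebesgue_on {a..b}) ?k2 / \<eta>) / 2"
      using \<phi>I by (rule integral_unique)
    also have "\<dots> \<le> (\<eta> * (b - a) + (\<eta>\<^sup>2 * (b - a)) / \<eta>) / 2"
      using k2I \<eta>(1) by (intro divide_right_mono add_left_mono) auto
    also have "\<dots> = \<eta> * (b - a)" using \<eta>(1) by (simp add: power2_eq_square)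
    also have "\<dots> \<le> \<eta>" using \<eta>(1) ab by (simp add: mult_le_cancel_left1)
    finally show ?thesis .
  qed
  show "norm (h t) < r" if t: "t \<in> {a..b}" for t
  proof (rule ccontr)
    assume r': "\<not> norm (h t) < r"
    have h: "norm (h s) \<ge> \<eta>" if "s \<in> {a..b}" for s
    proof -
      have "norm (h t - h s) \<le> \<eta>"
        using osc[of s t] osc[of t s] that t by (cases "s \<le> t") (auto simp: norm_minus_commute)
      then show ?thesis using r' norm_triangle_ineq2[of "h t" "h s"] by (simp add: \<eta>_def)
    qed
    \<comment> \<open>Integrating the constant \<open>\<eta>\<^sup>2\<close> yields exactly the
      threshold in \<open>small\<close>.\<close>
    have "ennreal (\<eta>\<^sup>2 * (b - a)) = (\<integral>\<^sup>+ s\<in>{a..b}. ennreal (\<eta>\<^sup>2) \<partial>lebesgue)"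
      using ab by (simp add: nn_integral_cmult_indicator ennreal_mult)
    also have "\<dots> \<le> (\<integral>\<^sup>+ s\<in>{a..b}. ennreal ((norm (h s))\<^sup>2 + (norm (k s))\<^sup>2) \<partial>lebesgue)"
    proof (intro nn_integral_mono)
      fix s
      show "ennreal (\<eta>\<^sup>2) * indicator {a..b} s \<le> ennreal ((norm (h s))\<^sup>2 + (norm (k s))\<^sup>2) * indicator {a..b} s"
        using h[of s] \<eta>(1) by (cases "s \<in> {a..b}") (auto intro!: ennreal_leI add_increasing2 power_mono)
    qed
    finally show False using small \<eta>(2) by simp
  qed
qed

section \<open>Tangent vectors, forms and metrics in coordinates\<close>

lemma smooth_on_imp_continuous_on: "smooth_on S f \<Longrightarrow> continuous_on S f"
  unfolding smooth_on_def by (metis Ck_on.simps(1))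

lemma smooth_on_imp_differentiable: "smooth_on S f \<Longrightarrow> x \<in> S \<Longrightarrow> f differentiable at x"
  unfolding smooth_on_def by (metis Ck_on.simps(2))

context
  fixes A :: "('a::{t2_space, second_countable_topology}, 'n::finite) chart set"
  assumes atlas: "smooth_atlas A"
begin

lemma chart_domain:
  assumes "c \<in> A"
  shows open_chart_domain: "open (fst c)" and open_chart_image: "open (snd c ` fst c)"
    and chart_homeomorphism: "homeomorphism (fst c) (snd c ` fst c) (snd c) (param c)"
  using atlas assms unfolding smooth_atlas_def by auto

lemma param_chart: "c \<in> A \<Longrightarrow> p \<in> fst c \<Longrightarrow> param c (snd c p) = p"
  using chart_homeomorphism by (auto simp: homeomorphism_def)

lemma param_in_chart: "c \<in> A \<Longrightarrow> y \<in> snd c ` fst c \<Longrightarrow> param c y \<in> fst c"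
  by (metis imageE param_chart)

lemma ex_chart: "\<exists>c\<in>A. p \<in> fst c"
  using atlas unfolding smooth_atlas_def by blast

lemma open_chart_image_Int:
  assumes "c \<in> A" "open V"
  shows "open (snd c ` (fst c \<inter> V))"
  using homeomorphism_imp_open_map[OF chart_homeomorphism[OF assms(1)], of "fst c \<inter> V"]
    open_chart_image[OF assms(1)] assms(2)
  by (metis openin_open_Int openin_open_trans)

lemma transition_differentiable:
  assumes "c \<in> A" "c' \<in> A" "p \<in> fst c" "p \<in> fst c'"
  shows "transition c c' differentiable at (snd c p)"
  using atlas assms unfolding smooth_atlas_def
  by (intro smooth_on_imp_differentiable[of "snd c ` (fst c \<inter> fst c')"]) auto

lemma linear_chart_vector:
  assumes "c \<in> A" "p \<in> fst c"
  shows "linear (\<lambda>e. chart_vector A c p e c')"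
proof (cases "c' \<in> A \<and> p \<in> fst c'")
  case True
  then have "linear (frechet_derivative (transition c c') (at (snd c p)))"
    using transition_differentiable assms by (intro linear_frechet_derivative) auto
  then show ?thesis using True by (simp add: chart_vector_def linear_iff)
next
  case False
  then have "(\<lambda>e. chart_vector A c p e c') = (\<lambda>e. 0)"
    by (intro ext) (auto simp: chart_vector_def)
  then show ?thesis by (simp add: linear_iff)
qed

lemma chart_vector_tangent_vector:
  assumes "c \<in> A" "p \<in> fst c" "v \<in> tangent_space A p"
  shows "chart_vector A c p (v c) = v"
proof
  fix c' show "chart_vector A c p (v c) c' = v c'"
  proof (cases "c' \<in> A \<and> p \<in> fst c'")
    case True
    then have "v c' = frechet_derivative (transition c c') (at (snd c p)) (v c)"
      using assms unfolding tangent_space_def by blast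
    then show ?thesis using True by (simp add: chart_vector_def)
  next
    case False
    then have "v c' = 0" using assms(3) unfolding tangent_space_def by blast
    then show ?thesis using False by (auto simp: chart_vector_def)
  qed
qed

text \<open>The cocycle identity for differentials: on the overlap of three charts, the transition
  from \<open>c\<close> to \<open>c2\<close> factors through \<open>c1\<close>, and the chain rule
  applies. The identity of maps holds only on that overlap, which is why its image \<open>S\<close>
  has to be open.\<close>

lemma chart_vector_in_tangent_space:
  assumes c: "c \<in> A" "p \<in> fst c"
  shows "chart_vector A c p e \<in> tangent_space A p"
proof -
  have "chart_vector A c p e c2 = frechet_derivative (transition c1 c2) (at (snd c1 p)) (chart_vector A c p e c1)"
    if c12: "c1 \<in> A" "c2 \<in> A" "p \<in> fst c1" "p \<in> fst c2" for c1 c2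
  proof -
    define D where "D c c' = frechet_derivative (transition c c') (at (snd c p))" for c c' :: "('a, 'n) chart"
    have D: "(transition c c' has_derivative D c c') (at (snd c p))"
      if "c \<in> A" "c' \<in> A" "p \<in> fst c" "p \<in> fst c'" for c c'
      using transition_differentiable[OF that] by (simp add: D_def frechet_derivative_works)
    define S where "S = snd c ` (fst c \<inter> (fst c1 \<inter> fst c2))"
    have S: "open S" unfolding S_def
      using open_chart_image_Int[OF c(1)] open_chart_domain c12 by (simp add: open_Int)
    have p: "snd c p \<in> S" using c c12 by (auto simp: S_def)
    have t: "transition c c1 (snd c p) = snd c1 p" using c by (simp add: transition_def param_chart)
    have "(transition c1 c2 \<circ> transition c c1 has_derivative D c1 c2 \<circ> D c c1) (at (snd c p))"
      by (rule diff_chain_at) (use D c c12 t in auto)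
    then have "(transition c c2 has_derivative D c1 c2 \<circ> D c c1) (at (snd c p))"
      by (rule has_derivative_transform_within_open[OF _ S p])
         (use c c12 in \<open>auto simp: S_def transition_def param_chart\<close>)
    then have "D c c2 = D c1 c2 \<circ> D c c1"
      using D[of c c2] c c12 has_derivative_unique by blast
    then show ?thesis using c12 by (simp add: chart_vector_def D_def fun_eq_iff)
  qed
  moreover have "chart_vector A c p e c' = 0" if "c' \<notin> A \<or> p \<notin> fst c'" for c'
    using that by (auto simp: chart_vector_def)
  ultimately show ?thesis unfolding tangent_space_def by blast
qed

text \<open>Reduces linear algebra on families of components to the single chart \<open>c\<close>.
  Closure of the tangent space under finite sums, and linearity over such sums, are read off from
  it.\<close>

lemma lincomb_eq_chart_vector:
  assumes "c \<in> A" "p \<in> fst c" "\<And>i. i \<in> I \<Longrightarrow> V i \<in> tangent_space A p"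
  shows "lincomb I a V = chart_vector A c p (lincomb I a V c)"
proof
  fix c'
  have "lincomb I a V c' = (\<Sum>i\<in>I. a i *\<^sub>R chart_vector A c p (V i c) c')"
    unfolding lincomb_def
    by (intro sum.cong refl) (simp add: chart_vector_tangent_vector[OF assms])
  also have "\<dots> = chart_vector A c p (lincomb I a V c) c'"
    by (simp add: lincomb_def linear_sum[OF linear_chart_vector[OF assms(1,2), of c']]
      linear_scale[OF linear_chart_vector[OF assms(1,2), of c']])
  finally show "lincomb I a V c' = chart_vector A c p (lincomb I a V c) c'" .
qed

lemma lincomb_in_tangent_space:
  assumes "\<And>i. i \<in> I \<Longrightarrow> V i \<in> tangent_space A p"
  shows "lincomb I a V \<in> tangent_space A p"
proof -
  obtain c where c: "c \<in> A" "p \<in> fst c" using ex_chart by blast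
  show ?thesis
    by (rule ssubst[OF lincomb_eq_chart_vector[OF c assms]])
      (auto intro: chart_vector_in_tangent_space[OF c])
qed

lemma linear_tangent_linear:
  assumes "c \<in> A" "p \<in> fst c" "tangent_linear A p h"
  shows "linear (\<lambda>e. h (chart_vector A c p e))"
proof (rule linearI)
  have *: "h (chart_vector A c p (a *\<^sub>R e + b *\<^sub>R e')) = a * h (chart_vector A c p e) + b * h (chart_vector A c p e')" for a b e e'
  proof -
    have "chart_vector A c p (a *\<^sub>R e + b *\<^sub>R e') = (\<lambda>c'. a *\<^sub>R chart_vector A c p e c' + b *\<^sub>R chart_vector A c p e' c')"
      using linear_add[OF linear_chart_vector[OF assms(1,2)]] linear_scale[OF linear_chart_vector[OF assms(1,2)]]
      by (simp add: fun_eq_iff)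
    then show ?thesis
      using assms chart_vector_in_tangent_space unfolding tangent_linear_def by simp
  qed
  show "h (chart_vector A c p (e + e')) = h (chart_vector A c p e) + h (chart_vector A c p e')" for e e'
    using *[of 1 e 1 e'] by simp
  show "h (chart_vector A c p (r *\<^sub>R e)) = r *\<^sub>R h (chart_vector A c p e)" for r e
    using *[of r e 0 e] by simp
qed

text \<open>Expansion in the coordinate basis. Smoothness of forms and metrics is stated for
  constant component vectors only; this formula makes it usable for vectors that vary with the
  point.\<close>

lemma tangent_linear_coordinates:
  assumes "c \<in> A" "p \<in> fst c" "tangent_linear A p h" "v \<in> tangent_space A p"
  shows "h v = (\<Sum>i\<in>UNIV. v c $ i * h (chart_vector A c p (axis i 1)))"
proof -
  have e: "(\<Sum>i\<in>UNIV. v c $ i *\<^sub>R axis i 1) = v c"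
    using basis_expansion[of "v c"] unfolding scalar_mult_eq_scaleR .
  have "h v = h (chart_vector A c p (\<Sum>i\<in>UNIV. v c $ i *\<^sub>R axis i 1))"
    unfolding e chart_vector_tangent_vector[OF assms(1,2,4)] ..
  then show ?thesis
    by (simp add: linear_sum[OF linear_tangent_linear[OF assms(1-3)]]
      linear_scale[OF linear_tangent_linear[OF assms(1-3)]])
qed

lemma tangent_linear_lincomb:
  assumes "tangent_linear A p h" "\<And>i. i \<in> I \<Longrightarrow> V i \<in> tangent_space A p"
  shows "h (lincomb I a V) = (\<Sum>i\<in>I. a i * h (V i))"
proof -
  obtain c where c: "c \<in> A" "p \<in> fst c" using ex_chart by blast
  note L = linear_tangent_linear[OF c assms(1)]
  have "h (lincomb I a V) = h (chart_vector A c p (lincomb I a V c))"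
    by (rule arg_cong[OF lincomb_eq_chart_vector[OF c assms(2)]])
  also have "\<dots> = (\<Sum>i\<in>I. a i * h (chart_vector A c p (V i c)))"
    by (simp add: lincomb_def linear_sum[OF L] linear_scale[OF L])
  also have "\<dots> = (\<Sum>i\<in>I. a i * h (V i))"
    by (intro sum.cong refl) (simp add: chart_vector_tangent_vector[OF c assms(2)])
  finally show ?thesis .
qed

lemma lincomb_in_kernel_dist:
  assumes "tangent_linear A p (\<omega> p)" "\<And>i. i \<in> I \<Longrightarrow> V i \<in> kernel_dist A \<omega> p"
  shows "lincomb I a V \<in> kernel_dist A \<omega> p"
proof -
  have V: "V i \<in> tangent_space A p" "\<omega> p (V i) = 0" if "i \<in> I" for i
    using assms(2)[OF that] by (auto simp: kernel_dist_def)
  have "\<omega> p (lincomb I a V) = 0"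
    using tangent_linear_lincomb[OF assms(1) V(1)] V(2) by simp
  then show ?thesis using lincomb_in_tangent_space[OF V(1)] by (simp add: kernel_dist_def)
qed

lemma continuous_on_one_form_field:
  assumes c: "c \<in> A" and \<omega>: "smooth_one_form A \<omega>" and X: "smooth_vector_field_on A UNIV X"
  shows "continuous_on (snd c ` fst c) (\<lambda>y. \<omega> (param c y) (X (param c y)))"
proof -
  have "continuous_on (snd c ` fst c) 
      (\<lambda>y. \<Sum>i\<in>UNIV. X (param c y) c $ i * \<omega> (param c y) (chart_vector A c (param c y) (axis i 1)))"
  proof (intro continuous_intros)
    have "smooth_on (snd c ` (fst c \<inter> UNIV)) (\<lambda>y. X (param c y) c)"
      using c X unfolding smooth_vector_field_on_def by blast
    then show "continuous_on (snd c ` fst c) (\<lambda>y. X (param c y) c)"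
      by (simp add: smooth_on_imp_continuous_on)
    show "continuous_on (snd c ` fst c) (\<lambda>y. \<omega> (param c y) (chart_vector A c (param c y) (axis i 1)))" for i
      using c \<omega> unfolding smooth_one_form_def by (intro smooth_on_imp_continuous_on) blast
  qed
  moreover have "\<omega> (param c y) (X (param c y)) =
      (\<Sum>i\<in>UNIV. X (param c y) c $ i * \<omega> (param c y) (chart_vector A c (param c y) (axis i 1)))"
    if "y \<in> snd c ` fst c" for y
    by (rule tangent_linear_coordinates[OF c param_in_chart[OF c that]])
       (use \<omega> X in \<open>auto simp: smooth_one_form_def smooth_vector_field_on_def\<close>)
  ultimately show ?thesis by (simp cong: continuous_on_cong)
qed

text \<open>The metric coefficients are continuous, so the sum of their absolute values is bounded
  on the compact set \<open>Q\<close>, and each product of two components of \<open>v c\<close> is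
  at most \<open>(norm (v c))\<^sup>2\<close>.\<close>

lemma riemannian_metric_chart_bound:
  assumes c: "c \<in> A" and g: "riemannian_metric A g" and Q: "compact Q" "Q \<subseteq> snd c ` fst c"
  obtains G where "G \<ge> 0"
    "\<And>p v. p \<in> fst c \<Longrightarrow> snd c p \<in> Q \<Longrightarrow> v \<in> tangent_space A p \<Longrightarrow> g p v v \<le> G * (norm (v c))\<^sup>2"
proof -
  define b where "b i j y = g (param c y) (chart_vector A c (param c y) (axis i 1)) 
     (chart_vector A c (param c y) (axis j 1))" for i j y
  define \<phi> where "\<phi> y = (\<Sum>i\<in>UNIV. \<Sum>j\<in>UNIV. \<bar>b i j y\<bar>)" for y
  have "smooth_on (snd c ` fst c) (b i j)" for i j
    unfolding b_def using g[unfolded riemannian_metric_def, THEN conjunct2] c by blast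
  then have "continuous_on Q (b i j)" for i j
    using continuous_on_subset[OF smooth_on_imp_continuous_on Q(2)] by blast
  then have "continuous_on Q \<phi>"
    unfolding \<phi>_def by (intro continuous_on_sum continuous_on_rabs)
  then have "bounded (\<phi> ` Q)" by (intro compact_imp_bounded compact_continuous_image Q)
  then obtain G where G: "\<And>y. y \<in> Q \<Longrightarrow> \<bar>\<phi> y\<bar> \<le> G" by (auto simp: bounded_iff)
  show ?thesis
  \<comment> \<open>For empty \<open>Q\<close> the bound \<open>G\<close> is arbitrary and may be
    negative.\<close>
  proof (rule that[of "max G 0"])
    fix p v assume p: "p \<in> fst c" "snd c p \<in> Q" and v: "v \<in> tangent_space A p"
    have y: "param c (snd c p) = p" using p c by (simp add: param_chart)
    have tl: "tangent_linear A p (g p w)" and sym: "g p w w' = g p w' w" 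
      if "w \<in> tangent_space A p" "w' \<in> tangent_space A p" for w w'
      using g[unfolded riemannian_metric_def, THEN conjunct1] that by blast+
    have cv: "chart_vector A c p e \<in> tangent_space A p" for e
      by (rule chart_vector_in_tangent_space[OF c p(1)])
    have "g p v v = (\<Sum>i\<in>UNIV. v c $ i * g p v (chart_vector A c p (axis i 1)))"
      by (rule tangent_linear_coordinates[OF c p(1) tl[OF v v] v])
    also have "\<dots> = (\<Sum>i\<in>UNIV. v c $ i * g p (chart_vector A c p (axis i 1)) v)"
      using sym[OF v cv] by simp
    also have "\<dots> = (\<Sum>i\<in>UNIV. v c $ i * (\<Sum>j\<in>UNIV. v c $ j * b i j (snd c p)))"
      unfolding b_def y by (intro sum.cong refl arg_cong2[where f="(*)"] tangent_linear_coordinates[OF c p(1) tl[OF cv v] v])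
    also have "\<dots> = (\<Sum>i\<in>UNIV. \<Sum>j\<in>UNIV. (v c $ i * v c $ j) * b i j (snd c p))"
      by (simp add: sum_distrib_left mult.assoc)
    also have "\<dots> \<le> (\<Sum>i\<in>UNIV. \<Sum>j\<in>UNIV. (norm (v c))\<^sup>2 * \<bar>b i j (snd c p)\<bar>)"
    proof (intro sum_mono)
      fix i j :: 'n
      have "\<bar>v c $ i * v c $ j\<bar> \<le> (norm (v c))\<^sup>2"
        using component_le_norm_cart[of "v c" i] component_le_norm_cart[of "v c" j]
        unfolding abs_mult power2_eq_square by (intro mult_mono) auto
      then have "\<bar>(v c $ i * v c $ j) * b i j (snd c p)\<bar> \<le> (norm (v c))\<^sup>2 * \<bar>b i j (snd c p)\<bar>"
        unfolding abs_mult[of _ "b i j (snd c p)"] by (intro mult_right_mono) auto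
      then show "(v c $ i * v c $ j) * b i j (snd c p) \<le> (norm (v c))\<^sup>2 * \<bar>b i j (snd c p)\<bar>"
        by linarith
    qed
    also have "\<dots> = \<phi> (snd c p) * (norm (v c))\<^sup>2"
      by (simp add: \<phi>_def sum_distrib_left sum_distrib_right mult.commute)
    also have "\<dots> \<le> max G 0 * (norm (v c))\<^sup>2"
      using G[OF p(2)] by (intro mult_right_mono) auto
    finally show "g p v v \<le> max G 0 * (norm (v c))\<^sup>2" .
  qed simp
qed

end

section \<open>Pointwise estimate of the metric under admissible controls\<close>

lemma riemannian_metric_nonneg:
  assumes g: "riemannian_metric A g" and v: "v \<in> tangent_space A p"
  shows "g p v v \<ge> 0"
proof (cases "v = tzero")
  case True
  have "g p v (\<lambda>c. 0 *\<^sub>R v c + 0 *\<^sub>R v c) = 0 * g p v v + 0 * g p v v"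
    using g[unfolded riemannian_metric_def, THEN conjunct1] v unfolding tangent_linear_def by blast
  then show ?thesis using True by (simp add: tzero_def)
next
  case False
  then show ?thesis
    using g[unfolded riemannian_metric_def, THEN conjunct1] v by (metis less_imp_le)
qed

text \<open>With \<open>n = - \<omega> p (X 0 p)\<close> and \<open>u 0 = \<xi>\<^sup>2\<close>, the numerator of \<open>F\<close> is at most \<open>\<xi>\<^sup>4 + \<xi>\<^sup>2 C\<^sup>2\<close> and
  the denominator at least \<open>2 \<xi>\<^sup>2 n\<close>. Where \<open>\<xi> = 0\<close>, the velocity vanishes.\<close>

lemma randers_kropina_le:
  fixes A :: "('a::{t2_space, second_countable_topology}, 'n::finite) chart set"
  assumes atlas: "smooth_atlas A" and g: "riemannian_metric A g" and \<omega>: "tangent_linear A p (\<omega> p)"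
    and \<Lambda>: "\<Lambda> p \<ge> 0"
    and X0: "X 0 p \<in> tangent_space A p" "g p (X 0 p) (X 0 p) = 1"
      "\<And>v. v \<in> kernel_dist A \<omega> p \<Longrightarrow> g p (X 0 p) v = 0" "- \<omega> p (X 0 p) > 0"
    and X: "\<And>i. i \<in> {1..d} \<Longrightarrow> X i p \<in> kernel_dist A \<omega> p"
    and min: "\<And>u. g p (lincomb {1..d} u (\<lambda>i. X i p)) (lincomb {1..d} u (\<lambda>i. X i p)) \<le> (\<Sum>i=1..d. (u i)\<^sup>2)"
    and u: "u 0 = \<xi>\<^sup>2" "\<And>i. i \<in> {1..d} \<Longrightarrow> u i = \<xi> * \<alpha> i" "(\<Sum>i=1..d. (\<alpha> i)\<^sup>2) \<le> C\<^sup>2"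
  defines "v \<equiv> lincomb {0..d} u (\<lambda>i. X i p)"
  shows "(randers_kropina g \<omega> \<Lambda> p v)\<^sup>2 \<le> 1 / 4 + (g p v v + C ^ 4) / (2 * (\<omega> p (X 0 p))\<^sup>2)"
proof -
  define w where "w = lincomb {1..d} u (\<lambda>i. X i p)"
  have XT: "X i p \<in> tangent_space A p" if "i \<in> {1..d}" for i
    using X[OF that] by (simp add: kernel_dist_def)
  have wk: "w \<in> kernel_dist A \<omega> p"
    unfolding w_def by (rule lincomb_in_kernel_dist[where \<omega> = \<omega>, OF atlas \<omega> X])
  then have w: "w \<in> tangent_space A p" and \<omega>w: "\<omega> p w = 0" by (auto simp: kernel_dist_def)
  have v: "v = (\<lambda>c. u 0 *\<^sub>R X 0 p c + 1 *\<^sub>R w c)"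
    by (simp add: v_def w_def lincomb_def fun_eq_iff sum.atLeast_Suc_atMost)
  have vT: "v \<in> tangent_space A p"
    unfolding v_def
  proof (rule lincomb_in_tangent_space[OF atlas])
    fix i assume "i \<in> {0..d}"
    then show "X i p \<in> tangent_space A p" using X0(1) XT[of i] by (cases "i = 0") auto
  qed
  have \<omega>v: "\<omega> p v = u 0 * \<omega> p (X 0 p)"
  proof -
    have "\<omega> p (\<lambda>c. u 0 *\<^sub>R X 0 p c + 1 *\<^sub>R w c) = u 0 * \<omega> p (X 0 p) + 1 * \<omega> p w"
      using \<omega> X0(1) w unfolding tangent_linear_def by blast
    then show ?thesis by (simp add: v \<omega>w)
  qed
  have sym: "g p a b = g p b a" if "a \<in> tangent_space A p" "b \<in> tangent_space A p" for a b
    using g[unfolded riemannian_metric_def, THEN conjunct1] that by blast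
  have lin: "g p a v = u 0 * g p a (X 0 p) + g p a w" if "a \<in> tangent_space A p" for a
  proof -
    have "tangent_linear A p (g p a)"
      using g[unfolded riemannian_metric_def, THEN conjunct1] that by blast
    then have "g p a (\<lambda>c. u 0 *\<^sub>R X 0 p c + 1 *\<^sub>R w c) = u 0 * g p a (X 0 p) + 1 * g p a w"
      using X0(1) w unfolding tangent_linear_def by blast
    then show ?thesis by (simp add: v)
  qed
  have gX0w: "g p (X 0 p) w = 0" by (rule X0(3)[OF wk])
  \<comment> \<open>Pythagoras: the mixed terms vanish because \<open>X 0\<close> is orthogonal to
    the horizontal part \<open>w\<close>.\<close>
  have "g p v v = u 0 * g p (X 0 p) v + g p w v"
    using lin[OF vT] sym[OF vT X0(1)] sym[OF vT w] by simp
  also have "\<dots> = (u 0)\<^sup>2 + g p w w"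
    using lin[OF X0(1)] lin[OF w] gX0w sym[OF w X0(1)] X0(2) by (simp add: power2_eq_square)
  finally have gv: "g p v v = (u 0)\<^sup>2 + g p w w" .
  have gpos: "g p a a \<ge> 0" "a \<noteq> tzero \<Longrightarrow> g p a a > 0" if "a \<in> tangent_space A p" for a
    using riemannian_metric_nonneg[OF g that] g that unfolding riemannian_metric_def by auto
  \<comment> \<open>\<open>min\<close> is applied to the given coefficients as one representation of
    \<open>w\<close>. The result is linear in \<open>u 0\<close>, which allows a factor
    \<open>u 0\<close> to cancel against the denominator of \<open>F\<close>.\<close>
  have gw: "g p w w \<le> u 0 * C\<^sup>2"
  proof -
    have "g p w w \<le> (\<Sum>i=1..d. (u i)\<^sup>2)" unfolding w_def by (rule min)
    also have "\<dots> = \<xi>\<^sup>2 * (\<Sum>i=1..d. (\<alpha> i)\<^sup>2)"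
      unfolding sum_distrib_left by (intro sum.cong refl) (simp add: u(2) power_mult_distrib)
    also have "\<dots> \<le> u 0 * C\<^sup>2" unfolding u(1) by (intro mult_left_mono u(3)) auto
    finally show ?thesis .
  qed
  define n where "n = - \<omega> p (X 0 p)"
  have n: "n > 0" "(\<omega> p (X 0 p))\<^sup>2 = n\<^sup>2" "\<omega> p v = - (u 0 * n)" using X0(4) \<omega>v by (auto simp: n_def)
  have rhs: "0 \<le> (g p v v + C ^ 4) / (2 * n\<^sup>2)"
    using gpos[OF vT] by (intro divide_nonneg_nonneg add_nonneg_nonneg) auto
  show ?thesis
  proof (cases "v = tzero")
    case True
    have "(randers_kropina g \<omega> \<Lambda> p v)\<^sup>2 \<le> 1/4"
      using True by (simp add: randers_kropina_def power2_eq_square)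
    then show ?thesis using rhs n(2) by simp
  next
    case False
    then have gvp: "g p v v > 0" using gpos[OF vT] by simp
    have u0: "u 0 > 0"
    proof (rule ccontr)
      assume "\<not> u 0 > 0"
      then have "u 0 = 0" using u(1) by (metis zero_less_power2 power_zero_numeral)
      then show False using gv gvp gw by simp
    qed
    define F where "F = randers_kropina g \<omega> \<Lambda> p v"
    have \<omega>neg: "\<omega> p v < 0" using n u0 by simp
    have F: "F = g p v v / (- \<omega> p v + sqrt (\<Lambda> p * g p v v + (\<omega> p v)\<^sup>2))"
      using False \<omega>neg by (simp add: F_def randers_kropina_def)
    \<comment> \<open>Dropping the nonnegative \<open>\<Lambda>\<close> term treats the Randers and
      the Kropina points alike.\<close>
    have "sqrt ((\<omega> p v)\<^sup>2) \<le> sqrt (\<Lambda> p * g p v v + (\<omega> p v)\<^sup>2)"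
      using \<Lambda> gvp by (intro real_sqrt_le_mono) auto
    then have den: "- \<omega> p v + sqrt (\<Lambda> p * g p v v + (\<omega> p v)\<^sup>2) \<ge> 2 * (u 0 * n)"
      using \<omega>neg n(3) by (simp add: mult.commute)
    have "F \<le> g p v v / (2 * (u 0 * n))"
    proof -
      have "0 < 2 * (u 0 * n)" using u0 n by simp
      then show ?thesis unfolding F using den gvp by (intro frac_le) auto
    qed
    also have "\<dots> \<le> ((u 0)\<^sup>2 + u 0 * C\<^sup>2) / (2 * (u 0 * n))"
      using gv gw u0 n by (intro divide_right_mono) auto
    also have "\<dots> = (u 0 + C\<^sup>2) / (2 * n)" using u0 n by (simp add: field_simps power2_eq_square)
    finally have F1: "F \<le> (u 0 + C\<^sup>2) / (2 * n)" .
    have "0 \<le> F" unfolding F using gvp \<omega>neg \<Lambda> by (intro divide_nonneg_nonneg add_nonneg_nonneg) auto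
    then have "F\<^sup>2 \<le> ((u 0 + C\<^sup>2) / (2 * n))\<^sup>2" using F1 by (intro power_mono)
    also have "\<dots> = (u 0 + C\<^sup>2)\<^sup>2 / (4 * n\<^sup>2)" by (simp add: power_divide power_mult_distrib)
    \<comment> \<open>(a + b)^2 \<le> 2 (a^2 + b^2) separates the speed from the constant;
      afterwards \<open>(u 0)\<^sup>2\<close> is absorbed into \<open>g p v v\<close>.\<close>
    also have "\<dots> \<le> (2 * ((u 0)\<^sup>2 + C ^ 4)) / (4 * n\<^sup>2)"
    proof (rule divide_right_mono)
      have "0 \<le> (u 0 - C\<^sup>2)\<^sup>2" by simp
      then show "(u 0 + C\<^sup>2)\<^sup>2 \<le> 2 * ((u 0)\<^sup>2 + C ^ 4)"
        by (simp add: power2_sum power2_diff flip: power_mult)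
    qed simp
    also have "\<dots> \<le> (2 * (g p v v + C ^ 4)) / (4 * n\<^sup>2)"
      using gv gpos[OF w] by (intro divide_right_mono) auto
    also have "\<dots> = (g p v v + C ^ 4) / (2 * n\<^sup>2)" using n(1) by (simp add: divide_simps)
    finally show ?thesis using n(2) by (simp add: F_def)
  qed
qed

lemma admissible_controls_structure:
  assumes "u \<in> admissible_controls d C" "s \<in> {0..1}"
  obtains \<xi> \<alpha> where "u s 0 = \<xi>\<^sup>2" "\<And>i. i \<in> {1..d} \<Longrightarrow> u s i = \<xi> * \<alpha> i"
    "(\<Sum>i=1..d. (\<alpha> i)\<^sup>2) \<le> C\<^sup>2"
proof -
  obtain P where P: "partition_on {0..1} P" and J: "\<forall>J\<in>P. \<exists>\<xi>\<ge>0. \<exists>\<alpha>.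
           (\<forall>i\<in>{1..d}. \<alpha> i \<in> borel_measurable (lebesgue_on J)) \<and>
           (\<forall>s\<in>J. (\<Sum>i=1..d. (\<alpha> i s)\<^sup>2) \<le> C\<^sup>2) \<and>
           (\<forall>s\<in>J. u s 0 = \<xi>\<^sup>2 \<and> (\<forall>i\<in>{1..d}. u s i = \<xi> * \<alpha> i s))"
    using assms(1) unfolding admissible_controls_def by blast
  obtain J where "J \<in> P" "s \<in> J" using partition_onD1[OF P] assms(2) by blast
  then obtain \<xi> and \<alpha> :: "nat \<Rightarrow> real \<Rightarrow> real" where "(\<Sum>i=1..d. (\<alpha> i s)\<^sup>2) \<le> C\<^sup>2" "u s 0 = \<xi>\<^sup>2" 
    "\<forall>i\<in>{1..d}. u s i = \<xi> * \<alpha> i s" using bspec[OF J \<open>J \<in> P\<close>] by (elim exE conjE) blast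
  then show ?thesis using that[of \<xi> "\<lambda>i. \<alpha> i s"] by blast
qed

text \<open>Each piece has one \<open>\<xi>\<close>, and every component of \<open>\<alpha>\<close>
  is at most |C| in absolute value, so finiteness of the partition gives a bound. It necessarily
  depends on \<open>u\<close>, since \<open>\<xi>\<close> is unrestricted over all admissible
  controls.\<close>

lemma admissible_controls_bounded:
  fixes u :: "real \<Rightarrow> nat \<Rightarrow> real"
  assumes "u \<in> admissible_controls d C"
  obtains M where "\<And>s i. s \<in> {0..1} \<Longrightarrow> i \<le> d \<Longrightarrow> \<bar>u s i\<bar> \<le> (M::real)"
proof -
  obtain P where fin: "finite P" and P: "partition_on {0..1} P" and J: "\<forall>J\<in>P. \<exists>\<xi>\<ge>0. \<exists>\<alpha>.
           (\<forall>i\<in>{1..d}. \<alpha> i \<in> borel_measurable (lebesgue_on J)) \<and>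
           (\<forall>s\<in>J. (\<Sum>i=1..d. (\<alpha> i s)\<^sup>2) \<le> C\<^sup>2) \<and>
           (\<forall>s\<in>J. u s 0 = \<xi>\<^sup>2 \<and> (\<forall>i\<in>{1..d}. u s i = \<xi> * \<alpha> i s))"
    using assms unfolding admissible_controls_def by blast
  have "\<exists>M::real. \<forall>s\<in>J. \<forall>i\<le>d. \<bar>u s i\<bar> \<le> M" if JP: "J \<in> P" for J
  proof -
    obtain \<xi> and \<alpha> :: "nat \<Rightarrow> real \<Rightarrow> real" where \<xi>: "\<xi> \<ge> 0" and \<alpha>: "\<forall>s\<in>J. (\<Sum>i=1..d. (\<alpha> i s)\<^sup>2) \<le> C\<^sup>2"
      and u: "\<forall>s\<in>J. u s 0 = \<xi>\<^sup>2 \<and> (\<forall>i\<in>{1..d}. u s i = \<xi> * \<alpha> i s)"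
      using bspec[OF J JP] by (elim exE conjE) blast
    have "\<bar>u s i\<bar> \<le> max (\<xi>\<^sup>2) (\<xi> * \<bar>C\<bar>)" if si: "s \<in> J" "i \<le> d" for s i
    proof (cases "i = 0")
      case False
      then have i: "i \<in> {1..d}" using si by auto
      have "(\<alpha> i s)\<^sup>2 \<le> (\<Sum>i=1..d. (\<alpha> i s)\<^sup>2)"
        by (rule member_le_sum[OF i]) auto
      then have "(\<alpha> i s)\<^sup>2 \<le> C\<^sup>2" using \<alpha> si(1) by fastforce
      then have "\<bar>\<alpha> i s\<bar> \<le> \<bar>C\<bar>" by (rule abs_le_square_iff[THEN iffD2])
      then have "\<bar>u s i\<bar> \<le> \<xi> * \<bar>C\<bar>"
        using u si(1) i \<xi> by (simp add: abs_mult mult_left_mono)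
      then show ?thesis by simp
    qed (use u si in auto)
    then show ?thesis by blast
  qed
  then have "\<forall>J\<in>P. \<exists>M::real. \<forall>s\<in>J. \<forall>i\<le>d. \<bar>u s i\<bar> \<le> M" by blast
  from bchoice[OF this] obtain M where M: "\<forall>J\<in>P. \<forall>s\<in>J. \<forall>i\<le>d. \<bar>u s i\<bar> \<le> M J" ..
  show ?thesis
  proof (rule that[of "\<Sum>J\<in>P. \<bar>M J\<bar>"])
    fix s :: real and i assume si: "s \<in> {0..1}" "i \<le> d"
    obtain J where J: "J \<in> P" "s \<in> J" using partition_onD1[OF P] si by blast
    have "\<bar>u s i\<bar> \<le> \<bar>M J\<bar>" using M J si(2) by (meson abs_ge_self order_trans)
    also have "\<dots> \<le> (\<Sum>J\<in>P. \<bar>M J\<bar>)" by (rule member_le_sum[OF J(1)]) (use fin in auto)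
    finally show "\<bar>u s i\<bar> \<le> (\<Sum>J\<in>P. \<bar>M J\<bar>)" .
  qed
qed

text \<open>Derivatives within the nondegenerate interval are unique even at its endpoints, and both
  families vanish in charts that do not contain the point.\<close>

lemma velocity_eq:
  assumes v: "has_velocity A \<sigma> v s" "v \<in> tangent_space A (\<sigma> s)" and s: "s \<in> {0..1}"
  shows "velocity A \<sigma> s = v"
proof
  fix c
  show "velocity A \<sigma> s c = v c"
  proof (cases "c \<in> A \<and> \<sigma> s \<in> fst c")
    case True
    then have "((snd c \<circ> \<sigma>) has_vector_derivative v c) (at s within cbox 0 1)"
      using v(1) unfolding has_velocity_def by simp
    then have "vector_derivative (snd c \<circ> \<sigma>) (at s within cbox 0 1) = v c"
      using s by (intro vector_derivative_within_cbox) auto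
    then show ?thesis using True by (simp add: velocity_def)
  next
    case False
    then have "v c = 0" using v(2) unfolding tangent_space_def by blast
    then show ?thesis using False by (auto simp: velocity_def)
  qed
qed

lemma homeomorphism_open_preimage:
  assumes "homeomorphism S T f f'" "open S" "open B"
  shows "open (S \<inter> f -` B)"
  using assms by (intro continuous_open_preimage) (auto simp: homeomorphism_def)

text \<open>The closed interval is what \<open>W12_ball\<close> takes as its domain, and
  \<open>V\<close>, open in the whole line, is what a later covering of {0..1} needs. Clipping to
  {0..1} keeps the interval nondegenerate when \<open>t\<close> is 0 or 1.\<close>

lemma compact_interval_nbhd:
  fixes \<sigma> :: "real \<Rightarrow> 'a::topological_space"
  assumes \<sigma>: "continuous_on {0..1} \<sigma>" and W: "open W" "\<sigma> t \<in> W" and t: "t \<in> {0..1}"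
  obtains a b V where "0 \<le> a" "a < b" "b \<le> 1" "\<sigma> ` {a..b} \<subseteq> W" "open V" "t \<in> V" "V \<inter> {0..1} \<subseteq> {a..b}"
proof -
  obtain T where T: "open T" "T \<inter> {0..1} = \<sigma> -` W \<inter> {0..1}"
    using \<sigma> W(1) unfolding continuous_on_open_invariant by blast
  have "t \<in> T" using T(2) W(2) t by blast
  then obtain \<delta> where \<delta>: "\<delta> > 0" "ball t \<delta> \<subseteq> T" using T(1) open_contains_ball by blast
  define a where "a = max 0 (t - \<delta>/2)"
  define b where "b = min 1 (t + \<delta>/2)"
  have ab: "0 \<le> a" "a < b" "b \<le> 1" using t \<delta>(1) by (auto simp: a_def b_def)
  have "{a..b} \<subseteq> ball t \<delta> \<inter> {0..1}"
  proof
    fix s assume "s \<in> {a..b}"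
    then have "t - \<delta>/2 \<le> s" "s \<le> t + \<delta>/2" and s: "s \<in> {0..1}" by (auto simp: a_def b_def)
    then have "\<bar>s - t\<bar> \<le> \<delta>/2" by linarith
    with s show "s \<in> ball t \<delta> \<inter> {0..1}" using \<delta>(1) by (auto simp: dist_real_def abs_minus_commute)
  qed
  then have "\<sigma> ` {a..b} \<subseteq> W" using \<delta>(2) T(2) by blast
  then show ?thesis
    by (rule that[of a b "{t - \<delta>/2 <..< t + \<delta>/2}", OF ab]) (use \<delta>(1) in \<open>auto simp: a_def b_def\<close>)
qed

section \<open>Local bounds for the energy near a curve of the control system\<close>

context
  fixes A :: "('a::{t2_space, second_countable_topology}, 'n::finite) chart set"
    and g :: "'a \<Rightarrow> ('a, 'n) tvec \<Rightarrow> ('a, 'n) tvec \<Rightarrow> real"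
    and \<omega> :: "'a \<Rightarrow> ('a, 'n) tvec \<Rightarrow> real"
    and \<Lambda> :: "'a \<Rightarrow> real" and C :: real and d :: nat
    and X :: "nat \<Rightarrow> 'a \<Rightarrow> ('a, 'n) tvec"
    and x0 x1 :: 'a
  assumes atlas: "smooth_atlas A" and metric: "riemannian_metric A g"
    and form: "smooth_one_form A \<omega>" and Lambda: "\<And>x. \<Lambda> x \<ge> 0"
    and fields: "\<And>i. i \<in> {0..d} \<Longrightarrow> smooth_vector_field_on A UNIV (X i)"
    and kernel: "\<And>i x. i \<in> {1..d} \<Longrightarrow> X i x \<in> kernel_dist A \<omega> x"
    and min: "\<And>u x. g x (lincomb {1..d} u (\<lambda>i. X i x)) (lincomb {1..d} u (\<lambda>i. X i x)) \<le> (\<Sum>i=1..d. (u i)\<^sup>2)"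
    and unit: "\<And>x. g x (X 0 x) (X 0 x) = 1"
    and orth: "\<And>x v. v \<in> kernel_dist A \<omega> x \<Longrightarrow> g x (X 0 x) v = 0"
    and pos: "\<And>x. - \<omega> x (X 0 x) > 0"
begin

lemma field_in_tangent_space: "i \<in> {0..d} \<Longrightarrow> X i x \<in> tangent_space A x"
  using fields unfolding smooth_vector_field_on_def by blast

text \<open>The energy is written with \<open>velocity\<close>, the control system with
  \<open>has_velocity\<close>. The two agree almost everywhere because the combination of the fields
  is a tangent vector.\<close>

lemma Omega_set_velocity:
  assumes "\<sigma> \<in> Omega_set A d X C x0 x1"
  obtains u where "u \<in> admissible_controls d C" "abs_cont_curve A \<sigma>"
    "AE s in lebesgue. s \<in> {0..1} \<longrightarrow> has_velocity A \<sigma> (velocity A \<sigma> s) s \<and>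
       velocity A \<sigma> s = lincomb {0..d} (u s) (\<lambda>i. X i (\<sigma> s))"
proof -
  obtain u where u: "u \<in> admissible_controls d C" "control_solution A d X x0 u \<sigma>"
    using assms unfolding Omega_set_def by blast
  then have "AE s in lebesgue_on {0..1}. has_velocity A \<sigma> (lincomb {0..d} (u s) (\<lambda>i. X i (\<sigma> s))) s"
    unfolding control_solution_def by blast
  then have AE: "AE s in lebesgue. s \<in> {0..1} \<longrightarrow> has_velocity A \<sigma> (lincomb {0..d} (u s) (\<lambda>i. X i (\<sigma> s))) s"
    by (subst (asm) AE_restrict_space_iff) auto
  have "AE s in lebesgue. s \<in> {0..1} \<longrightarrow> has_velocity A \<sigma> (velocity A \<sigma> s) s \<and>
       velocity A \<sigma> s = lincomb {0..d} (u s) (\<lambda>i. X i (\<sigma> s))"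
    using AE
  proof (eventually_elim, intro impI)
    fix s :: real assume s: "s \<in> {0..1}" and imp: "s \<in> {0..1} \<longrightarrow> has_velocity A \<sigma> (lincomb {0..d} (u s) (\<lambda>i. X i (\<sigma> s))) s"
    have "lincomb {0..d} (u s) (\<lambda>i. X i (\<sigma> s)) \<in> tangent_space A (\<sigma> s)"
      by (rule lincomb_in_tangent_space[OF atlas]) (rule field_in_tangent_space)
    then have "velocity A \<sigma> s = lincomb {0..d} (u s) (\<lambda>i. X i (\<sigma> s))"
      using imp s by (intro velocity_eq) auto
    then show "has_velocity A \<sigma> (velocity A \<sigma> s) s \<and>
       velocity A \<sigma> s = lincomb {0..d} (u s) (\<lambda>i. X i (\<sigma> s))" using imp s by simp
  qed
  then show ?thesis using that u unfolding control_solution_def by blast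
qed

text \<open>The fields are bounded on the compact set \<open>Q\<close> and the controls on {0..1}.
  As \<open>B\<close> depends on \<open>\<sigma>\<close>, this serves the centre of a neighbourhood
  only, not its other members.\<close>

lemma chart_speed_bounded:
  assumes \<sigma>: "\<sigma> \<in> Omega_set A d X C x0 x1" and c: "c \<in> A" and Q: "compact Q" "Q \<subseteq> snd c ` fst c"
  obtains B where "AE s in lebesgue. s \<in> {0..1} \<and> \<sigma> s \<in> fst c \<and> snd c (\<sigma> s) \<in> Q \<longrightarrow> norm (velocity A \<sigma> s c) \<le> B"
proof -
  obtain u where u: "u \<in> admissible_controls d C" and AE: "AE s in lebesgue. s \<in> {0..1} \<longrightarrow>
      has_velocity A \<sigma> (velocity A \<sigma> s) s \<and> velocity A \<sigma> s = lincomb {0..d} (u s) (\<lambda>i. X i (\<sigma> s))"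
    using Omega_set_velocity[OF \<sigma>] by blast
  obtain M where M: "\<And>s i. s \<in> {0..1} \<Longrightarrow> i \<le> d \<Longrightarrow> \<bar>u s i\<bar> \<le> M"
    using admissible_controls_bounded[OF u] by blast
  have "\<exists>b. \<forall>y\<in>Q. norm (X i (param c y) c) \<le> b" if i: "i \<in> {0..d}" for i
  proof -
    have "smooth_on (snd c ` (fst c \<inter> UNIV)) (\<lambda>y. X i (param c y) c)"
      using fields[OF i] c unfolding smooth_vector_field_on_def by blast
    then have "continuous_on Q (\<lambda>y. X i (param c y) c)"
      using continuous_on_subset[OF smooth_on_imp_continuous_on Q(2)] by simp
    then have "bounded ((\<lambda>y. X i (param c y) c) ` Q)"
      by (intro compact_imp_bounded compact_continuous_image Q)
    then show ?thesis by (auto simp: bounded_iff)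
  qed
  then have "\<forall>i\<in>{0..d}. \<exists>b. \<forall>y\<in>Q. norm (X i (param c y) c) \<le> b" by blast
  from bchoice[OF this] obtain b where b: "\<forall>i\<in>{0..d}. \<forall>y\<in>Q. norm (X i (param c y) c) \<le> b i" ..
  show ?thesis
  proof (rule that[of "\<Sum>i=0..d. M * b i"])
    show "AE s in lebesgue. s \<in> {0..1} \<and> \<sigma> s \<in> fst c \<and> snd c (\<sigma> s) \<in> Q \<longrightarrow>
        norm (velocity A \<sigma> s c) \<le> (\<Sum>i=0..d. M * b i)"
      using AE
    proof (eventually_elim, intro impI)
      fix s :: real assume s: "s \<in> {0..1} \<and> \<sigma> s \<in> fst c \<and> snd c (\<sigma> s) \<in> Q"
        and "s \<in> {0..1} \<longrightarrow> has_velocity A \<sigma> (velocity A \<sigma> s) s \<and>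
          velocity A \<sigma> s = lincomb {0..d} (u s) (\<lambda>i. X i (\<sigma> s))"
      then have "velocity A \<sigma> s c = (\<Sum>i=0..d. u s i *\<^sub>R X i (\<sigma> s) c)" by (simp add: lincomb_def)
      moreover have "norm (u s i *\<^sub>R X i (\<sigma> s) c) \<le> M * b i" if i: "i \<in> {0..d}" for i
      proof -
        have "\<bar>u s i\<bar> \<le> M" using M s i by simp
        moreover have "norm (X i (\<sigma> s) c) \<le> b i"
          using bspec[OF bspec[OF b i], of "snd c (\<sigma> s)"] s param_chart[OF atlas c] by simp
        ultimately show ?thesis unfolding norm_scaleR by (intro mult_mono) auto
      qed
      ultimately show "norm (velocity A \<sigma> s c) \<le> (\<Sum>i=0..d. M * b i)"
        using sum_norm_le[of "{0..d}" "\<lambda>i. u s i *\<^sub>R X i (\<sigma> s) c" "\<lambda>i. M * b i"] by simp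
    qed
  qed
qed

text \<open>The order of quantifiers is the point: \<open>P\<close> and \<open>R\<close> are fixed
  before \<open>\<tau>\<close>. They arise from the pointwise bound by estimating the metric with
  \<open>G\<close> and replacing the norm of \<open>\<omega>\<close> by its minimum \<open>n\<close>
  over \<open>Q\<close>, which is attained and hence positive.\<close>

lemma randers_kropina_chart_bound:
  assumes c: "c \<in> A" and Q: "compact Q" "Q \<noteq> {}" "Q \<subseteq> snd c ` fst c"
  obtains P R where "P \<ge> 0" "R \<ge> 0" 
    "\<And>\<tau>. \<tau> \<in> Omega_set A d X C x0 x1 \<Longrightarrow>
     AE s in lebesgue. s \<in> {0..1} \<and> \<tau> s \<in> fst c \<and> snd c (\<tau> s) \<in> Q \<longrightarrow>
       (randers_kropina g \<omega> \<Lambda> (\<tau> s) (velocity A \<tau> s))\<^sup>2 \<le> P + R * (norm (velocity A \<tau> s c))\<^sup>2"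
proof -
  obtain G where G: "G \<ge> 0" "\<And>p v. p \<in> fst c \<Longrightarrow> snd c p \<in> Q \<Longrightarrow> v \<in> tangent_space A p \<Longrightarrow> g p v v \<le> G * (norm (v c))\<^sup>2"
    by (rule riemannian_metric_chart_bound[OF atlas c metric Q(1,3)]) blast
  have "continuous_on Q (\<lambda>y. - \<omega> (param c y) (X 0 (param c y)))"
    by (intro continuous_on_minus continuous_on_subset[OF _ Q(3)] continuous_on_one_form_field[OF atlas c form] fields) simp
  from continuous_attains_inf[OF Q(1,2) this]
  obtain y where y: "\<forall>z\<in>Q. - \<omega> (param c y) (X 0 (param c y)) \<le> - \<omega> (param c z) (X 0 (param c z))" ..
  define n where "n = - \<omega> (param c y) (X 0 (param c y))"
  have n: "n > 0" using pos[of "param c y"] by (simp add: n_def)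
  define P where "P = 1/4 + C ^ 4 / (2 * n\<^sup>2)"
  define R where "R = G / (2 * n\<^sup>2)"
  show ?thesis
  proof (rule that)
    show "P \<ge> 0" "R \<ge> 0" using G(1) by (auto simp: P_def R_def)
    fix \<tau> assume "\<tau> \<in> Omega_set A d X C x0 x1"
    then obtain u where u: "u \<in> admissible_controls d C" and AE: "AE s in lebesgue. s \<in> {0..1} \<longrightarrow>
      has_velocity A \<tau> (velocity A \<tau> s) s \<and> velocity A \<tau> s = lincomb {0..d} (u s) (\<lambda>i. X i (\<tau> s))"
      using Omega_set_velocity by blast
    show "AE s in lebesgue. s \<in> {0..1} \<and> \<tau> s \<in> fst c \<and> snd c (\<tau> s) \<in> Q \<longrightarrow>
       (randers_kropina g \<omega> \<Lambda> (\<tau> s) (velocity A \<tau> s))\<^sup>2 \<le> P + R * (norm (velocity A \<tau> s c))\<^sup>2"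
      using AE
    proof (eventually_elim, intro impI)
      fix s :: real assume s: "s \<in> {0..1} \<and> \<tau> s \<in> fst c \<and> snd c (\<tau> s) \<in> Q"
        and "s \<in> {0..1} \<longrightarrow> has_velocity A \<tau> (velocity A \<tau> s) s \<and>
          velocity A \<tau> s = lincomb {0..d} (u s) (\<lambda>i. X i (\<tau> s))"
      then have v: "velocity A \<tau> s = lincomb {0..d} (u s) (\<lambda>i. X i (\<tau> s))" by simp
      define v where "v = velocity A \<tau> s"
      obtain \<xi> \<alpha> where \<xi>: "u s 0 = \<xi>\<^sup>2" "\<And>i. i \<in> {1..d} \<Longrightarrow> u s i = \<xi> * \<alpha> i" "(\<Sum>i=1..d. (\<alpha> i)\<^sup>2) \<le> C\<^sup>2"
        using admissible_controls_structure[OF u] s by blast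
      have vT: "v \<in> tangent_space A (\<tau> s)"
        unfolding v_def v by (rule lincomb_in_tangent_space[OF atlas]) (rule field_in_tangent_space)
      have "(randers_kropina g \<omega> \<Lambda> (\<tau> s) v)\<^sup>2 \<le> 1/4 + (g (\<tau> s) v v + C ^ 4) / (2 * (\<omega> (\<tau> s) (X 0 (\<tau> s)))\<^sup>2)"
        unfolding v_def v
        by (rule randers_kropina_le[where A = A and X = X and \<xi> = \<xi> and \<alpha> = \<alpha>, OF atlas metric])
           (use form Lambda field_in_tangent_space[of 0] unit orth pos kernel min \<xi> in \<open>auto simp: smooth_one_form_def\<close>)
      also have "\<dots> \<le> 1/4 + (G * (norm (v c))\<^sup>2 + C ^ 4) / (2 * n\<^sup>2)"
      proof (intro add_left_mono frac_le mult_left_mono add_right_mono)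
        show "g (\<tau> s) v v \<le> G * (norm (v c))\<^sup>2" using G(2) s vT by blast
        have "n \<le> - \<omega> (\<tau> s) (X 0 (\<tau> s))"
          using bspec[OF y, of "snd c (\<tau> s)"] s param_chart[OF atlas c] by (simp add: n_def)
        then have "n\<^sup>2 \<le> (- \<omega> (\<tau> s) (X 0 (\<tau> s)))\<^sup>2" using n by (intro power_mono) auto
        then show "n\<^sup>2 \<le> (\<omega> (\<tau> s) (X 0 (\<tau> s)))\<^sup>2" by simp
      qed (use n G(1) in auto)
      also have "\<dots> = P + R * (norm (v c))\<^sup>2" by (simp add: P_def R_def add_divide_distrib)
      finally show "(randers_kropina g \<omega> \<Lambda> (\<tau> s) (velocity A \<tau> s))\<^sup>2 \<le> P + R * (norm (velocity A \<tau> s c))\<^sup>2"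
        by (simp add: v_def)
    qed
  qed
qed

text \<open>The dominating functions \<open>\<phi>\<close> are provided because the measurability of \<open>F\<close> along the
  curves is not at hand, and \<open>\<integral>\<^sup>+\<close> need not be additive on non-measurable functions.\<close>

lemma randers_kropina_local_bound:
  assumes \<sigma>: "\<sigma> \<in> Omega_set A d X C x0 x1" "\<sigma> \<in> W12_set A g x0 x1" and t: "t \<in> {0..1}"
  obtains V N M where "open V" "t \<in> V" "openin (W12 A g x0 x1) N" "\<sigma> \<in> N" "M < (\<infinity>::ennreal)"
    "\<And>\<tau>. \<tau> \<in> N \<Longrightarrow> \<tau> \<in> Omega_set A d X C x0 x1 \<Longrightarrow> \<exists>\<phi>\<in>borel_measurable lebesgue.
       (AE s in lebesgue. s \<in> V \<inter> {0..1} \<longrightarrow>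
          ennreal ((randers_kropina g \<omega> \<Lambda> (\<tau> s) (velocity A \<tau> s))\<^sup>2) \<le> \<phi> s) \<and>
       (\<integral>\<^sup>+ s. \<phi> s \<partial>lebesgue) \<le> M"
proof -
  obtain c where c: "c \<in> A" "\<sigma> t \<in> fst c" using ex_chart[OF atlas] by metis
  define y where "y = snd c (\<sigma> t)"
  obtain r0 where r0: "r0 > 0" "cball y r0 \<subseteq> snd c ` fst c"
    using open_chart_image[OF atlas c(1)] c(2) unfolding open_contains_cball y_def by blast
  \<comment> \<open>On \<open>{a..b}\<close>, \<open>\<sigma>\<close> stays within \<open>r\<close>
    of \<open>y\<close> and nearby curves stay within \<open>r\<close> of \<open>\<sigma>\<close>,
    so all of them remain in the ball of radius \<open>r0\<close>.\<close>
  define r where "r = r0 / 2"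
  define Q where "Q = cball y r0"
  have r: "r > 0" using r0 by (simp add: r_def)
  have Q: "compact Q" "Q \<noteq> {}" "Q \<subseteq> snd c ` fst c" using r0 by (auto simp: Q_def)
  define W where "W = fst c \<inter> snd c -` ball y r"
  have W: "open W" unfolding W_def
    by (rule homeomorphism_open_preimage[OF chart_homeomorphism[OF atlas c(1)] open_chart_domain[OF atlas c(1)]]) simp
  have cont: "continuous_on {0..1} \<sigma>" using \<sigma>(2) by (simp add: W12_set_def abs_cont_curve_def)
  have "\<sigma> t \<in> W" using c(2) r by (simp add: W_def y_def)
  then obtain a b V where ab: "0 \<le> a" "a < b" "b \<le> 1" and \<sigma>ab: "\<sigma> ` {a..b} \<subseteq> W"
    and V: "open V" "t \<in> V" "V \<inter> {0..1} \<subseteq> {a..b}"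
    using compact_interval_nbhd[OF cont W _ t] by blast
  have ab01: "{a..b} \<subseteq> {0..1}" using ab by auto
  have \<sigma>c: "\<sigma> ` {a..b} \<subseteq> fst c" using \<sigma>ab by (auto simp: W_def)
  \<comment> \<open>The threshold at which W12-closeness forces uniform distance less than
    \<open>r\<close>.\<close>
  define \<epsilon> where "\<epsilon> = r\<^sup>2 / 4 * (b - a)"
  have \<epsilon>: "\<epsilon> > 0" using r ab by (simp add: \<epsilon>_def)
  define N where "N = W12_ball A g x0 x1 c a b \<sigma> \<epsilon>"
  obtain P R where PR: "P \<ge> 0" "R \<ge> 0" and F: "\<And>\<tau>. \<tau> \<in> Omega_set A d X C x0 x1 \<Longrightarrow>
     AE s in lebesgue. s \<in> {0..1} \<and> \<tau> s \<in> fst c \<and> snd c (\<tau> s) \<in> Q \<longrightarrow>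
       (randers_kropina g \<omega> \<Lambda> (\<tau> s) (velocity A \<tau> s))\<^sup>2 \<le> P + R * (norm (velocity A \<tau> s c))\<^sup>2"
    by (rule randers_kropina_chart_bound[OF c(1) Q]) blast
  obtain B where B: "AE s in lebesgue. s \<in> {0..1} \<and> \<sigma> s \<in> fst c \<and> snd c (\<sigma> s) \<in> Q \<longrightarrow>
      norm (velocity A \<sigma> s c) \<le> B"
    by (rule chart_speed_bounded[OF \<sigma>(1) c(1) Q(1,3)])
  \<comment> \<open>From (B + x)^2 \<le> 2 B^2 + 2 x^2, where x is the norm of the velocity
    difference.\<close>
  define P' where "P' = P + 2 * R * B\<^sup>2"
  have P': "P' \<ge> 0" using PR by (simp add: P'_def)
  show ?thesis
  proof (rule that[OF V(1,2), of N "ennreal P' * ennreal (b - a) + ennreal (2 * R) * ennreal \<epsilon>"])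
    show "openin (W12 A g x0 x1) N"
      unfolding W12_def N_def
      by (rule topology_generated_by_Basis) (use c ab \<epsilon> \<sigma>(2) \<sigma>c in blast)
    show "\<sigma> \<in> N" unfolding N_def W12_ball_def using \<sigma>(2) \<sigma>c \<epsilon> by simp
    show "ennreal P' * ennreal (b - a) + ennreal (2 * R) * ennreal \<epsilon> < \<infinity>"
      by (simp add: ennreal_mult_less_top)
    fix \<tau> assume "\<tau> \<in> N" and \<tau>: "\<tau> \<in> Omega_set A d X C x0 x1"
    then have \<tau>c: "\<tau> ` {a..b} \<subseteq> fst c" and small: "(\<integral>\<^sup>+ s\<in>{a..b}. ennreal ((norm (snd c (\<tau> s) - snd c (\<sigma> s)))\<^sup>2 +
        (norm (velocity A \<tau> s c - velocity A \<sigma> s c))\<^sup>2) \<partial>lebesgue) < ennreal \<epsilon>"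
      by (auto simp: N_def W12_ball_def)
    define h where "h s = snd c (\<tau> s) - snd c (\<sigma> s)" for s
    define k where "k s = velocity A \<tau> s c - velocity A \<sigma> s c" for s
    have ac: "abs_cont_on a b (snd c \<circ> \<rho>) \<and> (AE s in lebesgue. s \<in> {a..b} \<longrightarrow>
        ((snd c \<circ> \<rho>) has_vector_derivative velocity A \<rho> s c) (at s within {a..b}))"
      if \<rho>: "\<rho> \<in> Omega_set A d X C x0 x1" "\<rho> ` {a..b} \<subseteq> fst c" for \<rho>
    proof -
      obtain u where \<rho>': "abs_cont_curve A \<rho>" "AE s in lebesgue. s \<in> {0..1} \<longrightarrow>
        has_velocity A \<rho> (velocity A \<rho> s) s \<and> velocity A \<rho> s = lincomb {0..d} (u s) (\<lambda>i. X i (\<rho> s))"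
        using Omega_set_velocity[OF \<rho>(1)] by blast
      have "AE s in lebesgue. s \<in> {a..b} \<longrightarrow>
        ((snd c \<circ> \<rho>) has_vector_derivative velocity A \<rho> s c) (at s within {a..b})"
        using \<rho>'(2)
      proof (eventually_elim, intro impI)
        fix s assume s: "s \<in> {a..b}" and "s \<in> {0..1} \<longrightarrow> has_velocity A \<rho> (velocity A \<rho> s) s \<and>
          velocity A \<rho> s = lincomb {0..d} (u s) (\<lambda>i. X i (\<rho> s))"
        then have "has_velocity A \<rho> (velocity A \<rho> s) s" using ab01 by blast
        then have "((snd c \<circ> \<rho>) has_vector_derivative velocity A \<rho> s c) (at s within {0..1})"
          using c(1) \<rho>(2) s unfolding has_velocity_def by blast
        then show "((snd c \<circ> \<rho>) has_vector_derivative velocity A \<rho> s c) (at s within {a..b})"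
          by (rule has_vector_derivative_within_subset[OF _ ab01])
      qed
      moreover have "abs_cont_on a b (snd c \<circ> \<rho>)"
        using \<rho>'(1) c(1) ab \<rho>(2) unfolding abs_cont_curve_def by (meson less_imp_le)
      ultimately show ?thesis by blast
    qed
    have h: "abs_cont_on a b h"
      using abs_cont_on_diff[of a b "snd c \<circ> \<tau>" "snd c \<circ> \<sigma>"] ac[OF \<tau> \<tau>c] ac[OF \<sigma>(1) \<sigma>c] by (simp add: h_def[abs_def])
    have "AE s in lebesgue. s \<in> {a..b} \<longrightarrow> (h has_vector_derivative k s) (at s within {a..b})"
      using ac[OF \<tau> \<tau>c, THEN conjunct2] ac[OF \<sigma>(1) \<sigma>c, THEN conjunct2]
    proof eventually_elim
      case (elim s)
      show ?case
      proof
        assume s: "s \<in> {a..b}"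
        have "((\<lambda>s. (snd c \<circ> \<tau>) s - (snd c \<circ> \<sigma>) s) has_vector_derivative k s) (at s within {a..b})"
          unfolding k_def
          by (rule has_vector_derivative_diff[OF elim(1)[rule_format, OF s] elim(2)[rule_format, OF s]])
        then show "(h has_vector_derivative k s) (at s within {a..b})" by (simp add: h_def[abs_def])
      qed
    qed
    then have hk: "AE s in lebesgue_on {a..b}. (h has_vector_derivative k s) (at s within {a..b})"
      by (subst AE_restrict_space_iff) auto
    have small': "(\<integral>\<^sup>+ s\<in>{a..b}. ennreal ((norm (h s))\<^sup>2 + (norm (k s))\<^sup>2) \<partial>lebesgue)
        < ennreal (r\<^sup>2 / 4 * (b - a))"
      using small by (simp add: h_def k_def \<epsilon>_def)
    have km: "k \<in> borel_measurable (lebesgue_on {a..b})" and hr: "\<And>s. s \<in> {a..b} \<Longrightarrow> norm (h s) < r"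
      using abs_cont_on_W12_small[OF ab(2) _ r h hk small'] ab by auto
    have \<sigma>Q: "snd c (\<sigma> s) \<in> Q" and \<tau>Q: "snd c (\<tau> s) \<in> Q" if s: "s \<in> {a..b}" for s
    proof -
      have 1: "dist y (snd c (\<sigma> s)) < r"
        using subsetD[OF \<sigma>ab imageI[OF s]] by (simp add: W_def)
      have 2: "dist (snd c (\<sigma> s)) (snd c (\<tau> s)) < r" using hr[OF s] by (simp add: h_def dist_norm norm_minus_commute)
      show "snd c (\<sigma> s) \<in> Q" using 1 r by (simp add: Q_def r_def)
      show "snd c (\<tau> s) \<in> Q" using 1 2 dist_triangle[of y "snd c (\<tau> s)" "snd c (\<sigma> s)"] by (simp add: Q_def r_def)
    qed
    \<comment> \<open>Expressed through \<open>k\<close>, whose measurability is known, instead of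
      through the velocity of \<open>\<tau>\<close>.\<close>
    define \<phi> where "\<phi> s = ennreal (P' + 2 * R * (norm (k s))\<^sup>2) * indicator {a..b} s" for s
    have m1: "(\<lambda>s. ennreal (P' + 2 * R * (norm (k s))\<^sup>2)) \<in> borel_measurable (lebesgue_on {a..b})"
      using km by measurable
    show "\<exists>\<phi>\<in>borel_measurable lebesgue.
       (AE s in lebesgue. s \<in> V \<inter> {0..1} \<longrightarrow>
          ennreal ((randers_kropina g \<omega> \<Lambda> (\<tau> s) (velocity A \<tau> s))\<^sup>2) \<le> \<phi> s) \<and>
       (\<integral>\<^sup>+ s. \<phi> s \<partial>lebesgue) \<le> ennreal P' * ennreal (b - a) + ennreal (2 * R) * ennreal \<epsilon>"
    proof (intro bexI[of _ \<phi>] conjI)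
      show "\<phi> \<in> borel_measurable lebesgue"
        unfolding \<phi>_def[abs_def] using m1 by (subst (asm) borel_measurable_restrict_space_iff_ennreal) auto
      show "AE s in lebesgue. s \<in> V \<inter> {0..1} \<longrightarrow>
          ennreal ((randers_kropina g \<omega> \<Lambda> (\<tau> s) (velocity A \<tau> s))\<^sup>2) \<le> \<phi> s"
        using F[OF \<tau>] B
      proof (eventually_elim, intro impI)
        fix s assume F: "s \<in> {0..1} \<and> \<tau> s \<in> fst c \<and> snd c (\<tau> s) \<in> Q \<longrightarrow>
            (randers_kropina g \<omega> \<Lambda> (\<tau> s) (velocity A \<tau> s))\<^sup>2 \<le> P + R * (norm (velocity A \<tau> s c))\<^sup>2"
          and B: "s \<in> {0..1} \<and> \<sigma> s \<in> fst c \<and> snd c (\<sigma> s) \<in> Q \<longrightarrow> norm (velocity A \<sigma> s c) \<le> B"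
          and sV: "s \<in> V \<inter> {0..1}"
        then have s: "s \<in> {a..b}" "s \<in> {0..1}" using V(3) by auto
        have B': "norm (velocity A \<sigma> s c) \<le> B" using B s \<sigma>Q[OF s(1)] \<sigma>c by blast
        have "norm (velocity A \<tau> s c) \<le> norm (velocity A \<sigma> s c) + norm (k s)"
          using norm_triangle_ineq[of "velocity A \<sigma> s c" "k s"] by (simp add: k_def)
        also have "\<dots> \<le> B + norm (k s)" using B' by simp
        finally have "(norm (velocity A \<tau> s c))\<^sup>2 \<le> (B + norm (k s))\<^sup>2" by (intro power_mono) auto
        also have "\<dots> \<le> 2 * B\<^sup>2 + 2 * (norm (k s))\<^sup>2"
          using zero_le_power2[of "B - norm (k s)"] by (simp add: power2_sum power2_diff)
        finally have "R * (norm (velocity A \<tau> s c))\<^sup>2 \<le> R * (2 * B\<^sup>2 + 2 * (norm (k s))\<^sup>2)"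
          by (rule mult_left_mono[OF _ PR(2)])
        moreover have "(randers_kropina g \<omega> \<Lambda> (\<tau> s) (velocity A \<tau> s))\<^sup>2 \<le> P + R * (norm (velocity A \<tau> s c))\<^sup>2"
          using F s \<tau>Q[OF s(1)] \<tau>c by blast
        ultimately have "(randers_kropina g \<omega> \<Lambda> (\<tau> s) (velocity A \<tau> s))\<^sup>2 \<le> P' + 2 * R * (norm (k s))\<^sup>2"
          by (simp add: P'_def algebra_simps)
        then show "ennreal ((randers_kropina g \<omega> \<Lambda> (\<tau> s) (velocity A \<tau> s))\<^sup>2) \<le> \<phi> s"
          using s by (simp add: \<phi>_def ennreal_leI)
      qed
      have "(\<integral>\<^sup>+ s. \<phi> s \<partial>lebesgue) = (\<integral>\<^sup>+ s. ennreal (P' + 2 * R * (norm (k s))\<^sup>2) \<partial>lebesgue_on {a..b})"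
        unfolding \<phi>_def by (subst nn_integral_restrict_space) auto
      also have "\<dots> = (\<integral>\<^sup>+ s. ennreal P' + ennreal (2 * R) * ennreal ((norm (k s))\<^sup>2) \<partial>lebesgue_on {a..b})"
        using P' PR by (intro nn_integral_cong) (simp add: ennreal_plus ennreal_mult)
      also have "\<dots> = ennreal P' * emeasure (lebesgue_on {a..b}) (space (lebesgue_on {a..b})) +
          ennreal (2 * R) * (\<integral>\<^sup>+ s. ennreal ((norm (k s))\<^sup>2) \<partial>lebesgue_on {a..b})"
        using km by (subst nn_integral_add) (auto simp: nn_integral_cmult)
      also have "emeasure (lebesgue_on {a..b}) (space (lebesgue_on {a..b})) = ennreal (b - a)"
        using ab by (simp add: emeasure_restrict_space)
      also have "(\<integral>\<^sup>+ s. ennreal ((norm (k s))\<^sup>2) \<partial>lebesgue_on {a..b}) \<le> ennreal \<epsilon>"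
      proof -
        have "(\<integral>\<^sup>+ s. ennreal ((norm (k s))\<^sup>2) \<partial>lebesgue_on {a..b}) = (\<integral>\<^sup>+ s\<in>{a..b}. ennreal ((norm (k s))\<^sup>2) \<partial>lebesgue)"
          by (subst nn_integral_restrict_space) auto
        also have "\<dots> \<le> (\<integral>\<^sup>+ s\<in>{a..b}. ennreal ((norm (h s))\<^sup>2 + (norm (k s))\<^sup>2) \<partial>lebesgue)"
          by (intro nn_integral_mono mult_right_mono ennreal_leI) auto
        finally show ?thesis using small' by (simp add: \<epsilon>_def)
      qed
      finally show "(\<integral>\<^sup>+ s. \<phi> s \<partial>lebesgue) \<le> ennreal P' * ennreal (b - a) + ennreal (2 * R) * ennreal \<epsilon>"
        by (simp add: add_left_mono mult_left_mono)
    qed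
  qed
qed

text \<open>By compactness of {0..1}, finitely many sets \<open>V t\<close> cover it. Intersecting
  the neighbourhoods and adding the dominating functions suffices; where the sets \<open>V t\<close>
  overlap, the sum only gets larger.\<close>

lemma energy_locally_bounded:
  assumes \<sigma>: "\<sigma> \<in> Omega_set A d X C x0 x1" "\<sigma> \<in> W12_set A g x0 x1"
  obtains N M where "openin (W12 A g x0 x1) N" "\<sigma> \<in> N" "M < (\<infinity>::ennreal)"
    "\<And>\<tau>. \<tau> \<in> N \<Longrightarrow> \<tau> \<in> Omega_set A d X C x0 x1 \<Longrightarrow> energy A g \<omega> \<Lambda> \<tau> \<le> M"
proof -
  define F where "F \<tau> s = ennreal ((randers_kropina g \<omega> \<Lambda> (\<tau> s) (velocity A \<tau> s))\<^sup>2)" for \<tau> s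
  have "\<forall>t\<in>{0..1}. \<exists>V N M. open V \<and> t \<in> V \<and> openin (W12 A g x0 x1) N \<and> \<sigma> \<in> N \<and> M < (\<infinity>::ennreal) \<and>
    (\<forall>\<tau>\<in>N \<inter> Omega_set A d X C x0 x1. \<exists>\<phi>\<in>borel_measurable lebesgue.
       (AE s in lebesgue. s \<in> V \<inter> {0..1} \<longrightarrow> F \<tau> s \<le> \<phi> s) \<and> (\<integral>\<^sup>+ s. \<phi> s \<partial>lebesgue) \<le> M)"
  proof
    fix t :: real assume t: "t \<in> {0..1}"
    show "\<exists>V N M. open V \<and> t \<in> V \<and> openin (W12 A g x0 x1) N \<and> \<sigma> \<in> N \<and> M < (\<infinity>::ennreal) \<and>
    (\<forall>\<tau>\<in>N \<inter> Omega_set A d X C x0 x1. \<exists>\<phi>\<in>borel_measurable lebesgue.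
       (AE s in lebesgue. s \<in> V \<inter> {0..1} \<longrightarrow> F \<tau> s \<le> \<phi> s) \<and> (\<integral>\<^sup>+ s. \<phi> s \<partial>lebesgue) \<le> M)"
      by (rule randers_kropina_local_bound[OF \<sigma> t]) (unfold F_def, blast)
  qed
  from bchoice[OF this] obtain V where "\<forall>t\<in>{0..1}. \<exists>N M. open (V t) \<and> t \<in> V t \<and> openin (W12 A g x0 x1) N \<and> \<sigma> \<in> N \<and> M < (\<infinity>::ennreal) \<and>
    (\<forall>\<tau>\<in>N \<inter> Omega_set A d X C x0 x1. \<exists>\<phi>\<in>borel_measurable lebesgue.
       (AE s in lebesgue. s \<in> V t \<inter> {0..1} \<longrightarrow> F \<tau> s \<le> \<phi> s) \<and> (\<integral>\<^sup>+ s. \<phi> s \<partial>lebesgue) \<le> M)" ..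
  from bchoice[OF this] obtain N where "\<forall>t\<in>{0..1}. \<exists>M. open (V t) \<and> t \<in> V t \<and> openin (W12 A g x0 x1) (N t) \<and> \<sigma> \<in> N t \<and> M < (\<infinity>::ennreal) \<and>
    (\<forall>\<tau>\<in>N t \<inter> Omega_set A d X C x0 x1. \<exists>\<phi>\<in>borel_measurable lebesgue.
       (AE s in lebesgue. s \<in> V t \<inter> {0..1} \<longrightarrow> F \<tau> s \<le> \<phi> s) \<and> (\<integral>\<^sup>+ s. \<phi> s \<partial>lebesgue) \<le> M)" ..
  from bchoice[OF this] obtain M where M: "\<forall>t\<in>{0..1}. open (V t) \<and> t \<in> V t \<and> openin (W12 A g x0 x1) (N t) \<and> \<sigma> \<in> N t \<and> M t < (\<infinity>::ennreal) \<and>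
    (\<forall>\<tau>\<in>N t \<inter> Omega_set A d X C x0 x1. \<exists>\<phi>\<in>borel_measurable lebesgue.
       (AE s in lebesgue. s \<in> V t \<inter> {0..1} \<longrightarrow> F \<tau> s \<le> \<phi> s) \<and> (\<integral>\<^sup>+ s. \<phi> s \<partial>lebesgue) \<le> M t)" ..
  obtain T where T: "T \<subseteq> {0..1}" "finite T" "{0..1} \<subseteq> (\<Union>t\<in>T. V t)"
    by (rule compactE_image[OF compact_Icc[of "0::real" 1], of "{0..1}" V]) (use M in blast)+
  \<comment> \<open>An empty intersection would be the whole type, which need not be open in
    \<open>W12\<close>.\<close>
  have "T \<noteq> {}" using T(3) by auto
  show ?thesis
  proof (rule that[of "\<Inter>t\<in>T. N t" "\<Sum>t\<in>T. M t"])
    show "openin (W12 A g x0 x1) (\<Inter>t\<in>T. N t)"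
      by (intro openin_INT2 T(2) \<open>T \<noteq> {}\<close>) (use M T(1) in blast)
    show "\<sigma> \<in> (\<Inter>t\<in>T. N t)" using M T(1) by blast
    show "(\<Sum>t\<in>T. M t) < \<infinity>" using M T(1) T(2) by (auto simp: subset_iff)
    fix \<tau> assume \<tau>: "\<tau> \<in> (\<Inter>t\<in>T. N t)" "\<tau> \<in> Omega_set A d X C x0 x1"
    have "\<forall>t\<in>T. \<exists>\<phi>. \<phi>\<in>borel_measurable lebesgue \<and>
       (AE s in lebesgue. s \<in> V t \<inter> {0..1} \<longrightarrow> F \<tau> s \<le> \<phi> s) \<and> (\<integral>\<^sup>+ s. \<phi> s \<partial>lebesgue) \<le> M t"
      using M T(1) \<tau> by blast
    from bchoice[OF this] obtain \<phi> where \<phi>: "\<forall>t\<in>T. \<phi> t \<in> borel_measurable lebesgue \<and>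
       (AE s in lebesgue. s \<in> V t \<inter> {0..1} \<longrightarrow> F \<tau> s \<le> \<phi> t s) \<and> (\<integral>\<^sup>+ s. \<phi> t s \<partial>lebesgue) \<le> M t" ..
    have AE: "AE s in lebesgue. \<forall>t\<in>T. s \<in> V t \<inter> {0..1} \<longrightarrow> F \<tau> s \<le> \<phi> t s"
      using \<phi> by (intro AE_finite_allI[OF T(2)]) blast
    have half: "ennreal (1/2) \<le> 1" by (rule ennreal_le_1[THEN iffD2]) simp
    have "energy A g \<omega> \<Lambda> \<tau> \<le> 1 * (\<integral>\<^sup>+ s\<in>{0..1}. F \<tau> s \<partial>lebesgue)"
      unfolding energy_def F_def by (rule mult_right_mono[OF half]) simp
    also have "\<dots> = (\<integral>\<^sup>+ s\<in>{0..1}. F \<tau> s \<partial>lebesgue)" by simp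
    also have "\<dots> \<le> (\<integral>\<^sup>+ s. (\<Sum>t\<in>T. \<phi> t s) \<partial>lebesgue)"
    proof (rule nn_integral_mono_AE, use AE in eventually_elim)
      fix s assume s: "\<forall>t\<in>T. s \<in> V t \<inter> {0..1} \<longrightarrow> F \<tau> s \<le> \<phi> t s"
      show "F \<tau> s * indicator {0..1} s \<le> (\<Sum>t\<in>T. \<phi> t s)"
      proof (cases "s \<in> {0..1}")
        case True
        then obtain t where t: "t \<in> T" "s \<in> V t" using T(3) by blast
        then have "F \<tau> s \<le> \<phi> t s" using s True by blast
        also have "\<dots> \<le> (\<Sum>t\<in>T. \<phi> t s)" by (rule member_le_sum[OF t(1)]) (use T(2) in auto)
        finally show ?thesis using True by simp
      qed simp
    qed
    also have "\<dots> = (\<Sum>t\<in>T. \<integral>\<^sup>+ s. \<phi> t s \<partial>lebesgue)"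
      by (rule nn_integral_sum) (use \<phi> in blast)
    also have "\<dots> \<le> (\<Sum>t\<in>T. M t)" by (rule sum_mono) (use \<phi> in blast)
    finally show "energy A g \<omega> \<Lambda> \<tau> \<le> (\<Sum>t\<in>T. M t)" .
  qed
qed

text \<open>A finite subcover by the neighbourhoods of local boundedness. Taking the sum of the
  bounds, not their maximum, includes the case of empty \<open>K\<close>.\<close>

lemma energy_bounded_on_compact:
  assumes K: "compactin (W12 A g x0 x1) K" "K \<subseteq> Omega_set A d X C x0 x1"
  shows "(SUP \<sigma>\<in>K. energy A g \<omega> \<Lambda> \<sigma>) < \<infinity>"
proof -
  have "topspace (W12 A g x0 x1) \<subseteq> W12_set A g x0 x1"
    unfolding W12_def topology_generated_by_topspace by (auto simp: W12_ball_def)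
  then have KW: "K \<subseteq> W12_set A g x0 x1" using compactin_subset_topspace[OF K(1)] by blast
  have "\<forall>\<sigma>\<in>K. \<exists>N. openin (W12 A g x0 x1) N \<and> \<sigma> \<in> N \<and> (\<exists>M < (\<infinity>::ennreal).
    \<forall>\<tau>\<in>N \<inter> Omega_set A d X C x0 x1. energy A g \<omega> \<Lambda> \<tau> \<le> M)"
  proof
    fix \<sigma> assume "\<sigma> \<in> K"
    then have "\<sigma> \<in> Omega_set A d X C x0 x1" "\<sigma> \<in> W12_set A g x0 x1" using K(2) KW by auto
    then show "\<exists>N. openin (W12 A g x0 x1) N \<and> \<sigma> \<in> N \<and> (\<exists>M < (\<infinity>::ennreal).
      \<forall>\<tau>\<in>N \<inter> Omega_set A d X C x0 x1. energy A g \<omega> \<Lambda> \<tau> \<le> M)"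
      by (rule energy_locally_bounded) blast
  qed
  from bchoice[OF this] obtain N where N: "\<forall>\<sigma>\<in>K. openin (W12 A g x0 x1) (N \<sigma>) \<and> \<sigma> \<in> N \<sigma> \<and> (\<exists>M < (\<infinity>::ennreal).
    \<forall>\<tau>\<in>N \<sigma> \<inter> Omega_set A d X C x0 x1. energy A g \<omega> \<Lambda> \<tau> \<le> M)" ..
  then have "\<forall>\<sigma>\<in>K. \<exists>M. M < (\<infinity>::ennreal) \<and> (\<forall>\<tau>\<in>N \<sigma> \<inter> Omega_set A d X C x0 x1. energy A g \<omega> \<Lambda> \<tau> \<le> M)"
    by blast
  from bchoice[OF this] obtain M where M: "\<forall>\<sigma>\<in>K. M \<sigma> < (\<infinity>::ennreal) \<and>
    (\<forall>\<tau>\<in>N \<sigma> \<inter> Omega_set A d X C x0 x1. energy A g \<omega> \<Lambda> \<tau> \<le> M \<sigma>)" ..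
  have "\<exists>\<F>. finite \<F> \<and> \<F> \<subseteq> N ` K \<and> K \<subseteq> \<Union>\<F>"
    using K(1) N unfolding compactin_def by (elim conjE allE[of _ "N ` K"]) blast
  then obtain S where S: "finite S" "S \<subseteq> K" "K \<subseteq> (\<Union>\<sigma>\<in>S. N \<sigma>)"
    by (metis finite_subset_image)
  have "energy A g \<omega> \<Lambda> \<tau> \<le> (\<Sum>\<sigma>\<in>S. M \<sigma>)" if \<tau>: "\<tau> \<in> K" for \<tau>
  proof -
    obtain \<sigma> where \<sigma>: "\<sigma> \<in> S" "\<tau> \<in> N \<sigma>" using S(3) \<tau> by blast
    then have "energy A g \<omega> \<Lambda> \<tau> \<le> M \<sigma>" using M S(2) \<tau> K(2) by blast
    also have "\<dots> \<le> (\<Sum>\<sigma>\<in>S. M \<sigma>)" by (rule member_le_sum[OF \<sigma>(1)]) (use S(1) in auto)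
    finally show ?thesis .
  qed
  then have "(SUP \<sigma>\<in>K. energy A g \<omega> \<Lambda> \<sigma>) \<le> (\<Sum>\<sigma>\<in>S. M \<sigma>)" by (rule SUP_least)
  also have "\<dots> < \<infinity>" using S(1,2) M by (auto simp: subset_iff)
  finally show ?thesis .
qed

end

section \<open>Positivity of the norm of the form, and the conclusion\<close>

text \<open>If \<open>\<omega>\<close> vanished on \<open>N\<close>, then \<open>N\<close> would lie
  in the kernel and be orthogonal to itself. The sign comes from the norm being at least
  |\<omega>(N)|. As the norm is a supremum of reals, this requires the set to be bounded above,
  which is the purpose of \<open>bound\<close>.\<close>

lemma unit_normal_covector_pos:
  fixes A :: "('a::{t2_space, second_countable_topology}, 'n::finite) chart set"
  assumes atlas: "smooth_atlas A" and g: "riemannian_metric A g" and \<omega>: "tangent_linear A p (\<omega> p)"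
    and N: "N \<in> tangent_space A p" "g p N N = 1" "\<And>v. v \<in> kernel_dist A \<omega> p \<Longrightarrow> g p N v = 0"
    and norm: "- \<omega> p N = covector_norm A g \<omega> p"
  shows "- \<omega> p N > 0"
proof -
  have \<omega>N: "\<omega> p N \<noteq> 0"
  proof
    assume "\<omega> p N = 0"
    then have "N \<in> kernel_dist A \<omega> p" using N(1) by (simp add: kernel_dist_def)
    then show False using N(2,3) by fastforce
  qed
  have sym: "g p a b = g p b a" and tl: "tangent_linear A p (g p a)"
    if "a \<in> tangent_space A p" "b \<in> tangent_space A p" for a b
    using g[unfolded riemannian_metric_def, THEN conjunct1] that by blast+
  have bound: "\<bar>\<omega> p v\<bar> \<le> \<bar>\<omega> p N\<bar>" if v: "v \<in> tangent_space A p" "g p v v \<le> 1" for v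
  proof -
    \<comment> \<open>Chosen so that v - a N lies in the kernel. Pythagoras then gives a^2 \<le>
      g(v, v) \<le> 1.\<close>
    define a where "a = \<omega> p v / \<omega> p N"
    define w where "w = (\<lambda>c. 1 *\<^sub>R v c + (- a) *\<^sub>R N c)"
    have "w = lincomb {0..1} (\<lambda>i. if i = 0 then 1 else - a) (\<lambda>i. if i = 0 then v else N)"
      by (simp add: w_def lincomb_def)
    also have "\<dots> \<in> tangent_space A p"
      by (rule lincomb_in_tangent_space[OF atlas]) (simp add: v N)
    finally have w: "w \<in> tangent_space A p" .
    have "\<omega> p w = 1 * \<omega> p v + (- a) * \<omega> p N"
      using \<omega> v(1) N(1) unfolding w_def tangent_linear_def by blast
    then have "w \<in> kernel_dist A \<omega> p" using w \<omega>N by (simp add: kernel_dist_def a_def)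
    then have Nw: "g p N w = 0" by (rule N(3))
    have v_eq: "v = (\<lambda>c. 1 *\<^sub>R w c + a *\<^sub>R N c)" by (intro ext) (simp add: w_def)
    have lin: "g p b v = g p b w + a * g p b N" if b: "b \<in> tangent_space A p" for b
    proof -
      have "g p b (\<lambda>c. 1 *\<^sub>R w c + a *\<^sub>R N c) = 1 * g p b w + a * g p b N"
        using tl[OF b b] w N(1) unfolding tangent_linear_def by blast
      then show ?thesis using v_eq by simp
    qed
    have "g p v v = g p w v + a * g p N v"
      using lin[OF v(1)] sym[OF v(1) w] sym[OF v(1) N(1)] by simp
    also have "\<dots> = g p w w + a\<^sup>2"
      using lin[OF w] lin[OF N(1)] sym[OF w N(1)] Nw N(2) by (simp add: power2_eq_square)
    finally have "g p v v = g p w w + a\<^sup>2" .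
    moreover have "g p w w \<ge> 0" by (rule riemannian_metric_nonneg[OF g w])
    ultimately have "\<bar>a\<bar> \<le> 1" using v(2) by (simp add: abs_square_le_1[symmetric])
    then show ?thesis using \<omega>N by (simp add: a_def abs_divide divide_le_eq)
  qed
  have "\<bar>\<omega> p N\<bar> \<le> covector_norm A g \<omega> p"
    unfolding covector_norm_def
    by (rule cSUP_upper) (use N bound in \<open>auto intro!: bdd_aboveI2\<close>)
  then show ?thesis using norm \<omega>N by linarith
qed

theorem proposition4p5:
  fixes A :: "('a::{t2_space, second_countable_topology}, 'n::finite) chart set"
    and g :: "'a \<Rightarrow> ('a, 'n) tvec \<Rightarrow> ('a, 'n) tvec \<Rightarrow> real"
    and \<omega> :: "'a \<Rightarrow> ('a, 'n) tvec \<Rightarrow> real"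
    and \<Lambda> :: "'a \<Rightarrow> real"
    and z :: "nat \<Rightarrow> 'a"
    and U :: "nat \<Rightarrow> 'a set"
    and Y :: "nat \<Rightarrow> nat \<Rightarrow> 'a \<Rightarrow> ('a, 'n) tvec"
    and lam :: "nat \<Rightarrow> real"
    and omega_bar lambda C :: real
    and d :: nat
    and X :: "nat \<Rightarrow> 'a \<Rightarrow> ('a, 'n) tvec"
    and x0 x1 :: 'a
    and K :: "(real \<Rightarrow> 'a) set"
    and j f :: "(real \<Rightarrow> 'a) \<Rightarrow> (real \<Rightarrow> 'a)"
  assumes manifold: "smooth_atlas A" "connected (UNIV :: 'a set)" "CARD('n) \<ge> 2"
    and metric: "riemannian_metric A g"
    and form: "smooth_one_form A \<omega>" "\<And>x. \<exists>v\<in>tangent_space A x. \<omega> x v \<noteq> 0"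
    and Lambda: "smooth_fun A \<Lambda>" "\<And>x. \<Lambda> x \<ge> 0"
    and nonint: "nowhere_integrable A \<omega>"
    and omega_bounded: "bdd_above (range (covector_norm A g \<omega>))"
    and omega_bar: "omega_bar = (SUP x. covector_norm A g \<omega> x)"
    and cover: "\<And>k. open (U k)" "\<And>k. z k \<in> U k" "(\<Union>k. U k) = UNIV"
    and frames: "\<And>k. smooth_frame_on A \<omega> (U k) (Y k)"
      "\<And>k i x. i \<in> {1..CARD('n) - 1} \<Longrightarrow> x \<in> U k \<Longrightarrow> g x (Y k i x) (Y k i x) = 1"
    and lam: "\<And>k. bdd_below ((\<lambda>x. - \<omega> x (lie_bracket A (Y k 1) (Y k 2) x)) ` U k)"
      "\<And>k. lam k = (INF x\<in>U k. - \<omega> x (lie_bracket A (Y k 1) (Y k 2) x))"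
      "\<And>k. lam k > 0"
    and lambda: "lambda = (INF k. lam k)" "lambda > 0"
    and C: "C = sqrt (5 * (real CARD('n) + 3) * omega_bar / lambda)"
    and rank: "d \<ge> CARD('n) - 1"
    and fields: "\<And>i. i \<in> {1..d} \<Longrightarrow> smooth_vector_field_on A UNIV (X i)"
      "\<And>i x. i \<in> {1..d} \<Longrightarrow> X i x \<in> kernel_dist A \<omega> x"
    and generate: "\<And>x v. v \<in> kernel_dist A \<omega> x \<Longrightarrow>
        (\<exists>u. v = lincomb {1..d} u (\<lambda>i. X i x) \<and> g x v v = (\<Sum>i=1..d. (u i)\<^sup>2)) \<and>
        (\<forall>u. v = lincomb {1..d} u (\<lambda>i. X i x) \<longrightarrow> g x v v \<le> (\<Sum>i=1..d. (u i)\<^sup>2))"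
    and field0: "smooth_vector_field_on A UNIV (X 0)"
      "\<And>x. g x (X 0 x) (X 0 x) = 1"
      "\<And>x v. v \<in> kernel_dist A \<omega> x \<Longrightarrow> g x (X 0 x) v = 0"
      "\<And>x. - \<omega> x (X 0 x) = covector_norm A g \<omega> x"
    and K: "compactin (W12 A g x0 x1) K"
    and j: "\<And>\<sigma>. \<sigma> \<in> topspace (Omega12 A g d X C x0 x1) \<Longrightarrow> j \<sigma> = \<sigma>"
    and f: "homotopy_inverse (Omega12 A g d X C x0 x1) (W12 A g x0 x1) j f"
  shows "(SUP \<sigma>\<in>j ` f ` K. energy A g \<omega> \<Lambda> \<sigma>) < \<infinity>"
proof -
  have \<omega>: "tangent_linear A x (\<omega> x)" for x using form(1) unfolding smooth_one_form_def by blast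
  have X0: "X 0 x \<in> tangent_space A x" for x
    using field0(1) unfolding smooth_vector_field_on_def by blast
  have pos: "- \<omega> x (X 0 x) > 0" for x
    by (rule unit_normal_covector_pos[where \<omega> = \<omega>, OF manifold(1) metric \<omega> X0 field0(2,3,4)])
  have min: "g x (lincomb {1..d} u (\<lambda>i. X i x)) (lincomb {1..d} u (\<lambda>i. X i x)) \<le> (\<Sum>i=1..d. (u i)\<^sup>2)" for u x
  proof -
    have "lincomb {1..d} u (\<lambda>i. X i x) \<in> kernel_dist A \<omega> x"
      by (rule lincomb_in_kernel_dist[where \<omega> = \<omega>, OF manifold(1) \<omega> fields(2)])
    then show ?thesis using generate by blast
  qed
  have X: "smooth_vector_field_on A UNIV (X i)" if "i \<in> {0..d}" for i
    using that fields(1)[of i] field0(1) by (cases "i = 0") auto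
  have "continuous_map (W12 A g x0 x1) (Omega12 A g d X C x0 x1) f"
    using f unfolding homotopy_inverse_def by blast
  \<comment> \<open>Compactness in the subspace \<open>Omega12\<close> is compactness in
    \<open>W12\<close> together with containment in \<open>Omega_set\<close>, exactly the two
    premises of \<open>energy_bounded_on_compact\<close>.\<close>
  then have fK: "compactin (Omega12 A g d X C x0 x1) (f ` K)" by (rule image_compactin[OF K])
  then have fK': "compactin (W12 A g x0 x1) (f ` K)" "f ` K \<subseteq> Omega_set A d X C x0 x1"
    unfolding Omega12_def compactin_subtopology by auto
  \<comment> \<open>\<open>j\<close> is prescribed only on the topspace of \<open>Omega12\<close>,
    which contains the image of \<open>K\<close> under \<open>f\<close>.\<close>
  have "j ` f ` K = f ` K"
    using compactin_subset_topspace[OF fK] j by force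
  then show ?thesis
    using energy_bounded_on_compact[OF manifold(1) metric form(1) Lambda(2) X fields(2) min
        field0(2,3) pos fK'] by simp
qed

end
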